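(* Let $\mathbb{T}^2=\mathbb{R}^2/\mathbb{Z}^2$ and fix $\alpha>0$. For each $0<\hbar\leq 1$ let $(\psi_\hbar^j)_{j=1,\ldots,N(\hbar)}$ be any orthonormal basis of $\mathcal{H}_\hbar=\mathbf{1}_{[1-\alpha\hbar,1+\alpha\hbar]}(-\hbar^2\Delta)L^2(\mathbb{T}^2)$ made of eigenfunctions of $-\hbar^2\Delta$. Then there exist subsets $\Lambda(\hbar)\subset\{1,2,\ldots,N(\hbar)\}$ of full density, i.e. $\lim_{\hbar\to0}|\Lambda(\hbar)|/N(\hbar)=1$, such that, for all $a\in L^2(\mathbb{T}^2)$ (independent of $\hbar$), $$\lim_{\hbar\to 0,\ j\in\Lambda(\hbar)}\int_{\mathbb{T}^2}a(x)|\psi_\hbar^j(x)|^2\,dx=\int_{\mathbb{T}^2}a(x)\,dx.$$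
   Context: $\mathbb{T}^2=\mathbb{R}^2/\mathbb{Z}^2$ carries the standard flat metric, $\Delta$ is its Laplacian, and $dx$ is the normalized volume measure. The number $\alpha>0$ is fixed once and for all. For $0<\hbar\leq 1$, $\mathcal{H}_\hbar:=\mathbf{1}_{[1-\alpha\hbar,1+\alpha\hbar]}(-\hbar^2\Delta)L^2(\mathbb{T}^2)$ is the range of the spectral projector of $-\hbar^2\Delta$ onto $[1-\alpha\hbar,1+\alpha\hbar]$, i.e. the (finite-dimensional) span of the eigenfunctions of $-\hbar^2\Delta$ with eigenvalue in this interval, and $N(\hbar):=\dim\mathcal{H}_\hbar$. An orthonormal basis made of eigenfunctions means that each $\psi_\hbar^j$ satisfies $-\hbar^2\Delta\psi_\hbar^j=E_j(\hbar)\psi_\hbar^j$ for some $E_j(\hbar)\in[1-\alpha\hbar,1+\alpha\hbar]$. The notation $\lim_{\hbar\to 0,\,j\in\Lambda(\hbar)}F(\hbar,j)=L$ means that for every $\varepsilon>0$ there is $\hbar_\varepsilon>0$ such that $|F(\hbar,j)-L|<\varepsilon$ for all $0<\hbar<\hbar_\varepsilon$ and all $j\in\Lambda(\hbar)$. The sets $\Lambda(\hbar)$ do not depend on $a$. *)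

theory Defs
  imports "HOL-Analysis.Analysis"
begin

text \<open>
  Functions on the torus \<open>R\<^sup>2/Z\<^sup>2\<close> are represented by \<open>Z\<^sup>2\<close>-periodic functions on
  \<open>real^2\<close>. The unit square is a fundamental domain of area 1, so Lebesgue measure on it
  is the normalized volume measure of the flat torus.
\<close>

definition periodic :: "(real^2 \<Rightarrow> complex) \<Rightarrow> bool" where
  "periodic f \<longleftrightarrow> (\<forall>x k. (\<forall>i. k $ i \<in> \<int>) \<longrightarrow> f (x + k) = f x)"

definition dx :: "(real^2) measure" where
  "dx = lebesgue_on (cbox 0 (\<chi> i. 1))"

definition square_integrable :: "(real^2 \<Rightarrow> complex) \<Rightarrow> bool" where
  "square_integrable f \<longleftrightarrow>
     periodic f \<and> f \<in> borel_measurable dx \<and> integrable dx (\<lambda>x. (cmod (f x))\<^sup>2)"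

definition ae_equal :: "(real^2 \<Rightarrow> complex) \<Rightarrow> (real^2 \<Rightarrow> complex) \<Rightarrow> bool" where
  "ae_equal f g \<longleftrightarrow> square_integrable f \<and> square_integrable g \<and> (AE x in dx. f x = g x)"

lemma square_integrable_zero: "square_integrable (\<lambda>x. 0)"
  by (simp add: square_integrable_def periodic_def)

lemma square_integrable_add:
  assumes f: "square_integrable f" and g: "square_integrable g"
  shows "square_integrable (\<lambda>x. f x + g x)"
proof -
  note [measurable] = f[unfolded square_integrable_def, THEN conjunct2, THEN conjunct1]
    g[unfolded square_integrable_def, THEN conjunct2, THEN conjunct1]
  have bound: "(cmod (z + w))\<^sup>2 \<le> 2 * (cmod z)\<^sup>2 + 2 * (cmod w)\<^sup>2" for z w :: complex
  proof -
    have "(cmod (z + w))\<^sup>2 \<le> (cmod z + cmod w)\<^sup>2"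
      by (intro power_mono norm_triangle_ineq norm_ge_zero)
    also have "\<dots> \<le> 2 * (cmod z)\<^sup>2 + 2 * (cmod w)\<^sup>2"
      using zero_le_power2[of "cmod z - cmod w"] by (simp add: power2_eq_square algebra_simps)
    finally show ?thesis .
  qed
  have "integrable dx (\<lambda>x. (cmod (f x + g x))\<^sup>2)"
  proof (rule Bochner_Integration.integrable_bound)
    show "integrable dx (\<lambda>x. 2 * (cmod (f x))\<^sup>2 + 2 * (cmod (g x))\<^sup>2)"
      using f g by (simp add: square_integrable_def)
    show "AE x in dx. norm ((cmod (f x + g x))\<^sup>2)
        \<le> norm (2 * (cmod (f x))\<^sup>2 + 2 * (cmod (g x))\<^sup>2)"
      using bound by simp
  qed measurable
  then show ?thesis
    using f g by (simp add: square_integrable_def periodic_def)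
qed

lemma square_integrable_scale:
  "square_integrable f \<Longrightarrow> square_integrable (\<lambda>x. c * f x)"
  unfolding square_integrable_def
  by (auto simp: periodic_def norm_mult power_mult_distrib intro!: borel_measurable_times)

quotient_type L2_torus = "real^2 \<Rightarrow> complex" / partial: ae_equal
proof (rule part_equivpI)
  show "\<exists>f. ae_equal f f"
    using square_integrable_zero by (auto simp: ae_equal_def)
  show "symp ae_equal"
    by (rule sympI) (auto simp: ae_equal_def)
  show "transp ae_equal"
    by (rule transpI) (auto simp: ae_equal_def)
qed

instantiation L2_torus :: ab_group_add
begin

lift_definition zero_L2_torus :: L2_torus is "\<lambda>x. 0"
  by (simp add: ae_equal_def square_integrable_zero)

lift_definition plus_L2_torus :: "L2_torus \<Rightarrow> L2_torus \<Rightarrow> L2_torus" is "\<lambda>f g x. f x + g x"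
  by (auto simp: ae_equal_def square_integrable_add)

lift_definition uminus_L2_torus :: "L2_torus \<Rightarrow> L2_torus" is "\<lambda>f x. - f x"
  using square_integrable_scale[of _ "-1"] by (auto simp: ae_equal_def)

definition minus_L2_torus :: "L2_torus \<Rightarrow> L2_torus \<Rightarrow> L2_torus" where
  "minus_L2_torus u v = u + - v"

instance
proof
  fix u v w :: L2_torus
  show "u + v + w = u + (v + w)"
    by transfer (auto simp: ae_equal_def square_integrable_add algebra_simps)
  show "u + v = v + u"
    by transfer (auto simp: ae_equal_def square_integrable_add algebra_simps)
  show "0 + u = u"
    by transfer (auto simp: ae_equal_def)
  show "- u + u = 0"
    by transfer (auto simp: ae_equal_def square_integrable_zero)
  show "u - v = u + - v"
    by (rule minus_L2_torus_def)
qed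

end

lift_definition scale_L2 :: "complex \<Rightarrow> L2_torus \<Rightarrow> L2_torus" is "\<lambda>c f x. c * f x"
  by (auto simp: ae_equal_def square_integrable_scale)

interpretation L2: vector_space scale_L2
proof
  fix a b :: complex and u v :: L2_torus
  show "scale_L2 a (u + v) = scale_L2 a u + scale_L2 a v"
    by transfer
      (auto simp: ae_equal_def square_integrable_add square_integrable_scale algebra_simps)
  show "scale_L2 (a + b) u = scale_L2 a u + scale_L2 b u"
    by transfer
      (auto simp: ae_equal_def square_integrable_add square_integrable_scale distrib_right
        simp flip: distrib_right)
  show "scale_L2 a (scale_L2 b u) = scale_L2 (a * b) u"
    by transfer (auto simp: ae_equal_def square_integrable_scale algebra_simps)
  show "scale_L2 1 u = u"
    by transfer (auto simp: ae_equal_def)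
qed

lift_definition inner_L2 :: "L2_torus \<Rightarrow> L2_torus \<Rightarrow> complex"
  is "\<lambda>f g. LINT x|dx. f x * cnj (g x)"
proof -
  fix f f' g g' :: "real^2 \<Rightarrow> complex"
  assume "ae_equal f f'" "ae_equal g g'"
  then have [measurable]: "f \<in> borel_measurable dx" "f' \<in> borel_measurable dx"
      "g \<in> borel_measurable dx" "g' \<in> borel_measurable dx"
    and ae: "AE x in dx. f x = f' x" "AE x in dx. g x = g' x"
    by (auto simp: ae_equal_def square_integrable_def)
  have [measurable]: "cnj \<in> borel_measurable borel"
    by (intro borel_measurable_continuous_onI continuous_intros)
  have "AE x in dx. f x * cnj (g x) = f' x * cnj (g' x)"
    using ae by eventually_elim simp
  then show "(LINT x|dx. f x * cnj (g x)) = (LINT x|dx. f' x * cnj (g' x))"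
    by (intro integral_cong_AE) measurable
qed

lift_definition integral_L2 :: "L2_torus \<Rightarrow> complex" is "\<lambda>f. LINT x|dx. f x"
  unfolding ae_equal_def square_integrable_def by (intro integral_cong_AE) auto

text \<open>The pairing of \<open>a\<close> with the density \<open>|u|\<^sup>2\<close>, i.e. the integral of \<open>a |u|\<^sup>2\<close>.\<close>

lift_definition density_integral :: "L2_torus \<Rightarrow> L2_torus \<Rightarrow> complex"
  is "\<lambda>a f. LINT x|dx. a x * of_real ((cmod (f x))\<^sup>2)"
proof -
  fix a a' f f' :: "real^2 \<Rightarrow> complex"
  assume "ae_equal a a'" "ae_equal f f'"
  then have [measurable]: "a \<in> borel_measurable dx" "a' \<in> borel_measurable dx"
      "f \<in> borel_measurable dx" "f' \<in> borel_measurable dx"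
    and ae: "AE x in dx. a x = a' x" "AE x in dx. f x = f' x"
    by (auto simp: ae_equal_def square_integrable_def)
  have "AE x in dx. a x * of_real ((cmod (f x))\<^sup>2) = a' x * complex_of_real ((cmod (f' x))\<^sup>2)"
    using ae by eventually_elim simp
  then show "(LINT x|dx. a x * of_real ((cmod (f x))\<^sup>2)) =
        (LINT x|dx. a' x * of_real ((cmod (f' x))\<^sup>2))"
    by (intro integral_cong_AE) measurable
qed

definition partial_deriv :: "2 \<Rightarrow> (real^2 \<Rightarrow> complex) \<Rightarrow> real^2 \<Rightarrow> complex" where
  "partial_deriv i f x = frechet_derivative f (at x) (axis i 1)"

primrec C_k :: "nat \<Rightarrow> (real^2 \<Rightarrow> complex) \<Rightarrow> bool" where
  "C_k 0 f \<longleftrightarrow> continuous_on UNIV f"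
| "C_k (Suc k) f \<longleftrightarrow> f differentiable_on UNIV \<and> (\<forall>i. C_k k (partial_deriv i f))"

definition smooth_periodic :: "(real^2 \<Rightarrow> complex) \<Rightarrow> bool" where
  "smooth_periodic f \<longleftrightarrow> periodic f \<and> (\<forall>k. C_k k f)"

definition classical_laplacian :: "(real^2 \<Rightarrow> complex) \<Rightarrow> real^2 \<Rightarrow> complex" where
  "classical_laplacian f x = (\<Sum>i\<in>UNIV. partial_deriv i (partial_deriv i f) x)"

lemma smooth_periodic_measurable:
  assumes "smooth_periodic \<phi>"
  shows "\<phi> \<in> borel_measurable dx" "classical_laplacian \<phi> \<in> borel_measurable dx"
proof -
  have cont: "h \<in> borel_measurable dx" if "continuous_on UNIV h" for h :: "real^2 \<Rightarrow> complex"
    unfolding dx_def using that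
    by (intro continuous_imp_measurable_on_sets_lebesgue) (auto intro: continuous_on_subset)
  have "C_k 0 \<phi>" "C_k (Suc (Suc 0)) \<phi>"
    using assms unfolding smooth_periodic_def by blast+
  then have "continuous_on UNIV \<phi>" "continuous_on UNIV (classical_laplacian \<phi>)"
    unfolding classical_laplacian_def by (auto intro!: continuous_on_sum)
  then show "\<phi> \<in> borel_measurable dx" "classical_laplacian \<phi> \<in> borel_measurable dx"
    using cont by auto
qed

text \<open>
  The Laplacian as an unbounded operator on \<open>L\<^sup>2\<close>, given by its graph: \<open>u\<close> lies in the domain
  iff its distributional Laplacian is some \<open>v\<close> in \<open>L\<^sup>2\<close>. This is the self-adjoint realization
  on the torus. Such a \<open>v\<close> is unique.
\<close>

lift_definition has_laplacian :: "L2_torus \<Rightarrow> L2_torus \<Rightarrow> bool"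
  is "\<lambda>f g. \<forall>\<phi>. smooth_periodic \<phi> \<longrightarrow>
        (LINT x|dx. f x * classical_laplacian \<phi> x) = (LINT x|dx. g x * \<phi> x)"
proof -
  fix f f' g g' :: "real^2 \<Rightarrow> complex"
  assume "ae_equal f f'" "ae_equal g g'"
  then have m: "f \<in> borel_measurable dx" "f' \<in> borel_measurable dx"
      "g \<in> borel_measurable dx" "g' \<in> borel_measurable dx"
    and ae: "AE x in dx. f x = f' x" "AE x in dx. g x = g' x"
    by (auto simp: ae_equal_def square_integrable_def)
  have "(LINT x|dx. f x * classical_laplacian \<phi> x) = (LINT x|dx. f' x * classical_laplacian \<phi> x) \<and>
        (LINT x|dx. g x * \<phi> x) = (LINT x|dx. g' x * \<phi> x)" if "smooth_periodic \<phi>" for \<phi>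
  proof -
    note [measurable] = m smooth_periodic_measurable[OF that]
    have "AE x in dx. f x * classical_laplacian \<phi> x = f' x * classical_laplacian \<phi> x"
      "AE x in dx. g x * \<phi> x = g' x * \<phi> x"
      using ae by (eventually_elim, simp)+
    then show ?thesis
      by (intro conjI integral_cong_AE) measurable
  qed
  then show "(\<forall>\<phi>. smooth_periodic \<phi> \<longrightarrow>
        (LINT x|dx. f x * classical_laplacian \<phi> x) = (LINT x|dx. g x * \<phi> x)) \<longleftrightarrow>
      (\<forall>\<phi>. smooth_periodic \<phi> \<longrightarrow>
        (LINT x|dx. f' x * classical_laplacian \<phi> x) = (LINT x|dx. g' x * \<phi> x))"
    by (metis (no_types, lifting))
qed

definition eigenfunction :: "real \<Rightarrow> real \<Rightarrow> L2_torus \<Rightarrow> bool" where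
  "eigenfunction h E u \<longleftrightarrow> u \<noteq> 0 \<and>
     (\<exists>v. has_laplacian u v \<and> scale_L2 (of_real (- (h\<^sup>2))) v = scale_L2 (of_real E) u)"

definition window :: "real \<Rightarrow> real \<Rightarrow> real set" where
  "window \<alpha> h = {1 - \<alpha> * h .. 1 + \<alpha> * h}"

definition spectral_space :: "real \<Rightarrow> real \<Rightarrow> L2_torus set" where
  "spectral_space \<alpha> h = L2.span {u. \<exists>E\<in>window \<alpha> h. eigenfunction h E u}"

definition spectral_dim :: "real \<Rightarrow> real \<Rightarrow> nat" where
  "spectral_dim \<alpha> h = L2.dim (spectral_space \<alpha> h)"

definition orthonormal_eigenbasis :: "real \<Rightarrow> real \<Rightarrow> (nat \<Rightarrow> L2_torus) \<Rightarrow> bool" where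
  "orthonormal_eigenbasis \<alpha> h \<psi> \<longleftrightarrow>
     (\<forall>j\<in>{1..spectral_dim \<alpha> h}. \<exists>E\<in>window \<alpha> h. eigenfunction h E (\<psi> j)) \<and>
     (\<forall>i\<in>{1..spectral_dim \<alpha> h}. \<forall>j\<in>{1..spectral_dim \<alpha> h}.
        inner_L2 (\<psi> i) (\<psi> j) = (if i = j then 1 else 0)) \<and>
     L2.span (\<psi> ` {1..spectral_dim \<alpha> h}) = spectral_space \<alpha> h"

end

theory Submission
  imports Defs
begin

text \<open>
  The eigenfunctions with eigenvalue \<open>E\<close> are the trigonometric polynomials with frequencies on the
  circle \<open>4 \<pi>\<^sup>2 h\<^sup>2 |k|\<^sup>2 = E\<close>. For \<open>l \<noteq> 0\<close>, the Fourier coefficient of \<open>|\<psi>|\<^sup>2\<close> at \<open>l\<close> involves only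
  pairs \<open>k\<close>, \<open>k + l\<close> on the same circle, i.e. lattice points \<open>k\<close> on a fixed line. By Bessel's
  inequality the sum of the moduli of these coefficients over the whole eigenbasis is at most the
  number of lattice points in the intersection of that line with the spectral annulus, which is
  \<open>O(|l| h powr (-1/2))\<close>, whereas the annulus contains at least \<open>c / h\<close> lattice points. So, after
  discarding few indices, all coefficients with \<open>|l| \<le> h powr (-1/16)\<close> tend to zero uniformly, which
  settles trigonometric polynomials \<open>a\<close>. Zygmund's uniform \<open>L\<^sup>4\<close> bound for toral eigenfunctions
  and the density of trigonometric polynomials extend this to all \<open>a\<close> in \<open>L\<^sup>2\<close>.
\<close>

subsection \<open>Trigonometric monomials\<close>

text \<open>The sets \<open>\<Lambda> h\<close> have to be chosen before \<open>a\<close>, so the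
  range of controlled frequencies must grow as \<open>h\<close> tends to 0, and their number enters
  the count of discarded indices. Put \<open>r = h powr (- s)\<close>. There are O(r^2) frequencies,
  each with a sum O(r h^(-1/2)), and the threshold is 1/r, so O(r^4 h^(-1/2)) indices are lost. This
  is o(1/h) exactly when s < 1/8, and s = 1/16 is one such choice. The lower bound on the number of
  lattice points is delicate because the annulus has radius of order 1/h but a width that only tends
  to \<alpha>/(2 pi). For small \<alpha> it is thinner than the lattice spacing, and area counting
  fails because its error is of the order of the circumference, hence of the area itself. Lattice
  points are therefore exhibited where the annulus is nearly vertical and its vertical sections are
  long. As \<open>a\<close> is merely square integrable, replacing it by a trigonometric polynomial
  is harmless only if the densities |\<psi>|^2 are bounded in mean square uniformly; this is the
  role of the fourth-power bound.\<close>

definition mode :: "int \<times> int \<Rightarrow> real^2 \<Rightarrow> complex" where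
  "mode k x = exp (\<i> * of_real (2 * pi * (of_int (fst k) * x $ 1 + of_int (snd k) * x $ 2)))"

text \<open>The factor by which \<open>partial_deriv i\<close> multiplies
  \<open>mode k\<close>.\<close>

definition wave :: "int \<times> int \<Rightarrow> 2 \<Rightarrow> complex" where
  "wave k i = \<i> * of_real (2 * pi * of_int (if i = 1 then fst k else snd k))"

definition normsq :: "int \<times> int \<Rightarrow> int" where
  "normsq k = (fst k)\<^sup>2 + (snd k)\<^sup>2"

lemma mode_zero [simp]: "mode 0 x = 1"
  by (simp add: mode_def)

lemma mode_add: "mode (k + l) x = mode k x * mode l x"
  by (simp add: mode_def exp_add [symmetric] algebra_simps)

lemma cmod_mode [simp]: "cmod (mode k x) = 1"
  by (simp add: mode_def)

lemma cnj_mode: "cnj (mode k x) = mode (- k) x"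
  by (simp add: mode_def exp_cnj algebra_simps)

lemma mode_diff: "mode (k - l) x = mode k x * cnj (mode l x)"
  by (simp add: cnj_mode mode_add [symmetric])

lemma continuous_on_mode [continuous_intros]: "continuous_on S (mode k)"
  unfolding mode_def by (intro continuous_intros)

lemma periodic_mode: "periodic (mode k)"
  unfolding periodic_def
proof (intro allI impI)
  fix x v :: "real^2" assume "\<forall>i. v $ i \<in> \<int>"
  then obtain p q where pq: "v $ 1 = of_int p" "v $ 2 = of_int q"
    by (metis Ints_cases)
  have "mode k (x + v) = mode k x * exp (of_int (fst k * p + snd k * q) * (of_real (2 * pi) * \<i>))"
    by (simp add: mode_def exp_add [symmetric] pq algebra_simps)
  also have "exp (of_int (fst k * p + snd k * q) * (of_real (2 * pi) * \<i>)) = 1"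
    using exp_integer_2pi[of "of_int (fst k * p + snd k * q)"] by (simp add: mult_ac)
  finally show "mode k (x + v) = mode k x" by simp
qed

lemma has_derivative_mode:
  "(mode k has_derivative (\<lambda>v. (\<i> * of_real (2 * pi * (of_int (fst k) * v $ 1 + of_int (snd k) * v $ 2)))
      * mode k x)) (at x)"
proof -
  define L :: "real^2 \<Rightarrow> complex"
    where "L v = \<i> * of_real (2 * pi * (of_int (fst k) * v $ 1 + of_int (snd k) * v $ 2))" for v
  have "linear L"
    by (rule linearI) (auto simp: L_def algebra_simps scaleR_conv_of_real[where 'a = complex])
  then have "(L has_derivative L) (at x)"
    by (simp add: linear_conv_bounded_linear bounded_linear_imp_has_derivative)
  from has_derivative_compose[OF this DERIV_exp[unfolded has_field_derivative_def]]
  show ?thesis by (simp add: L_def mode_def[abs_def] mult.commute)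
qed

lemma partial_deriv_mode: "partial_deriv i (\<lambda>x. c * mode k x) = (\<lambda>x. c * wave k i * mode k x)"
proof
  fix x
  have "((\<lambda>x. c * mode k x) has_derivative (\<lambda>v. c * ((\<i> * of_real (2 * pi * (of_int (fst k) * v $ 1 + of_int (snd k) * v $ 2)))
      * mode k x))) (at x)"
    by (intro has_derivative_mult_right has_derivative_mode)
  then have "frechet_derivative (\<lambda>x. c * mode k x) (at x) = (\<lambda>v. c * ((\<i> * of_real (2 * pi * (of_int (fst k) * v $ 1 + of_int (snd k) * v $ 2)))
      * mode k x))"
    by (rule frechet_derivative_at [symmetric])
  moreover have "i = 1 \<or> i = 2" using exhaust_2 by blast
  ultimately show "partial_deriv i (\<lambda>x. c * mode k x) x = c * wave k i * mode k x"
    by (auto simp: partial_deriv_def wave_def axis_def)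
qed

text \<open>Each derivative only multiplies the scalar by \<open>wave k i\<close>, so the induction
  leaves \<open>c\<close> arbitrary to absorb that factor.\<close>

lemma C_k_mode: "C_k n (\<lambda>x. c * mode k x)"
proof (induction n arbitrary: c)
  case 0
  show ?case by (auto intro!: continuous_intros)
next
  case (Suc n)
  have "(\<lambda>x. c * mode k x) differentiable_on UNIV"
    unfolding differentiable_on_def differentiable_def
    by (blast intro: has_derivative_mult_right has_derivative_mode has_derivative_at_withinI)
  with Suc show ?case by (simp add: partial_deriv_mode)
qed

lemma smooth_periodic_mode: "smooth_periodic (mode k)"
  using C_k_mode[of _ 1 k] periodic_mode by (simp add: smooth_periodic_def)

lemma sum_wave: "(\<Sum>i\<in>UNIV. (wave k i)\<^sup>2) = - of_real (4 * pi\<^sup>2 * of_int (normsq k))"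
  by (simp add: UNIV_2 wave_def normsq_def power_mult_distrib algebra_simps)

lemma classical_laplacian_mode:
  "classical_laplacian (mode k) x = - of_real (4 * pi\<^sup>2 * of_int (normsq k)) * mode k x"
proof -
  have "partial_deriv i (partial_deriv i (mode k)) x = (wave k i)\<^sup>2 * mode k x" for i
    using partial_deriv_mode[of i 1 k] partial_deriv_mode[of i "wave k i" k]
    by (simp add: power2_eq_square)
  then show ?thesis
    by (simp add: classical_laplacian_def sum_distrib_right [symmetric] sum_wave)
qed

section \<open>Integration by parts over the unit square\<close>

abbreviation square :: "(real^2) set" where
  "square \<equiv> cbox 0 (\<chi> i. 1)"

text \<open>The square and its translate both arise from the box lengthened by \<open>t\<close> in
  direction \<open>i\<close>, by cutting off a slab at one end or the other. The two slabs differ by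
  a period, so they carry the same integral.\<close>

lemma integral_periodic_translate:
  fixes F :: "real^2 \<Rightarrow> complex"
  assumes per: "periodic F" and cont: "continuous_on UNIV F" and t: "0 \<le> t" "t \<le> 1"
  shows "integral square (\<lambda>x. F (x + t *\<^sub>R axis i 1)) = integral square F"
proof -
  define e :: "real^2" where "e = axis i 1"
  define I :: "real^2" where "I = (\<chi> i. 1)"
  have e_nth: "e $ j = (if j = i then 1 else 0)" for j
    by (simp add: e_def axis_def)
  have [simp]: "x \<bullet> e = x $ i" for x
    by (simp add: e_def inner_axis)
  have int: "F integrable_on cbox a b" for a b
    by (intro integrable_continuous continuous_on_subset[OF cont]) auto
  have e: "e \<in> Basis" by (auto simp: e_def Basis_vec_def)
  \<comment> \<open>\<open>b1\<close> and \<open>b2\<close> cut the long box at height 1,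
    \<open>b3\<close> and \<open>b4\<close> at height \<open>t\<close>.\<close>
  have b1: "cbox 0 (I + t *\<^sub>R e) \<inter> {x. x \<bullet> e \<le> 1} = cbox 0 I"
    using t exhaust_2[of i] by (auto simp: set_eq_iff mem_box_cart e_nth I_def forall_2)
  have b2: "cbox 0 (I + t *\<^sub>R e) \<inter> {x. x \<bullet> e \<ge> 1} = cbox e (I + t *\<^sub>R e)"
    using t exhaust_2[of i] by (auto simp: set_eq_iff mem_box_cart e_nth I_def forall_2)
  have b3: "cbox 0 (I + t *\<^sub>R e) \<inter> {x. x \<bullet> e \<le> t} = cbox 0 (I - e + t *\<^sub>R e)"
    using t exhaust_2[of i] by (auto simp: set_eq_iff mem_box_cart e_nth I_def forall_2)
  have b4: "cbox 0 (I + t *\<^sub>R e) \<inter> {x. x \<bullet> e \<ge> t} = cbox (t *\<^sub>R e) (I + t *\<^sub>R e)"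
    using t exhaust_2[of i] by (auto simp: set_eq_iff mem_box_cart e_nth I_def forall_2)
  have "F (x + e) = F x" for x
    using per by (auto simp: periodic_def e_nth)
  then have F: "integral (cbox e (I + t *\<^sub>R e)) F = integral (cbox 0 (I - e + t *\<^sub>R e)) F"
    using integral_shift_cbox_plus[where f = F and a = 0 and b = "I - e + t *\<^sub>R e" and c = e]
    by (simp add: o_def algebra_simps)
  have "integral (cbox 0 I) F = integral (cbox (t *\<^sub>R e) (I + t *\<^sub>R e)) F"
    using integral_split[OF int e, of 0 "I + t *\<^sub>R e" 1] integral_split[OF int e, of 0 "I + t *\<^sub>R e" t] F
    unfolding b1 b2 b3 b4 by simp
  also have "\<dots> = integral (cbox 0 I) (\<lambda>x. F (x + t *\<^sub>R e))"
    using integral_shift_cbox_plus[where f = F and a = 0 and b = I and c = "t *\<^sub>R e"]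
    by (simp add: o_def add.commute)
  finally show ?thesis by (simp add: I_def e_def)
qed

text \<open>The integral of a translate does not depend on the shift; differentiating under the
  integral sign at shift 0 gives the claim without iterated integrals or boundary terms.\<close>

lemma integral_partial_deriv:
  assumes per: "periodic F" and diff: "F differentiable_on UNIV"
    and cont: "continuous_on UNIV (partial_deriv i F)"
  shows "integral square (partial_deriv i F) = 0"
proof -
  define e :: "real^2" where "e = axis i 1"
  have contF: "continuous_on UNIV F"
    using diff by (rule differentiable_imp_continuous_on)
  have deriv: "((\<lambda>t. F (x + t *\<^sub>R e)) has_vector_derivative partial_deriv i F (x + t *\<^sub>R e)) (at t within {0..1})" for x t
  proof -
    have "F differentiable (at (x + t *\<^sub>R e))"
      using diff by (simp add: differentiable_on_def)
    then have D: "(F has_derivative frechet_derivative F (at (x + t *\<^sub>R e))) (at (x + t *\<^sub>R e))"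
      by (simp add: frechet_derivative_works)
    have "((\<lambda>t. F (x + t *\<^sub>R e)) has_derivative (\<lambda>s. frechet_derivative F (at (x + t *\<^sub>R e)) (s *\<^sub>R e))) (at t)"
      by (rule has_derivative_compose[where f = "\<lambda>t. x + t *\<^sub>R e", OF _ D])
        (auto intro!: derivative_eq_intros)
    moreover have "frechet_derivative F (at (x + t *\<^sub>R e)) (s *\<^sub>R e) = s *\<^sub>R partial_deriv i F (x + t *\<^sub>R e)" for s
      using linear_scale[OF has_derivative_linear[OF D]] by (simp add: partial_deriv_def e_def)
    ultimately show ?thesis
      by (simp add: has_vector_derivative_def has_derivative_at_withinI)
  qed
  have "((\<lambda>t. integral square (\<lambda>x. F (x + t *\<^sub>R e))) has_vector_derivative
      integral square (\<lambda>x. partial_deriv i F (x + 0 *\<^sub>R e))) (at 0 within {0..1})"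
  proof (rule leibniz_rule_vector_derivative[where fx = "\<lambda>t x. partial_deriv i F (x + t *\<^sub>R e)"])
    show "continuous_on ({0..1} \<times> square) (\<lambda>(t, x). partial_deriv i F (x + t *\<^sub>R e))"
      unfolding case_prod_unfold
      by (rule continuous_on_compose2[OF cont]) (auto intro!: continuous_intros)
    show "(\<lambda>x. F (x + t *\<^sub>R e)) integrable_on square" for t
      by (intro integrable_continuous continuous_on_compose2[OF contF]) (auto intro!: continuous_intros)
  qed (use deriv in auto)
  moreover have "((\<lambda>t. integral square (\<lambda>x. F (x + t *\<^sub>R e))) has_vector_derivative 0) (at 0 within {0..1})"
  proof (rule has_vector_derivative_transform[where f = "\<lambda>t. integral square F"])
    show "integral square (\<lambda>x. F (x + t *\<^sub>R e)) = integral square F" if "t \<in> {0..1}" for t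
      using that integral_periodic_translate[OF per contF] by (simp add: e_def)
  qed auto
  ultimately show ?thesis
    using vector_derivative_unique_within[of 0 "{0..1::real}"]
    by (metis (no_types, lifting) add_0_right atLeastAtMost_iff ext islimpt_Icc less_numeral_extra(1)
        not_bot order_refl scale_zero_left trivial_limit_within zero_le_one)
qed

lemma partial_deriv_mult:
  assumes "f differentiable (at x)" "g differentiable (at x)"
  shows "partial_deriv i (\<lambda>x. f x * g x) x = f x * partial_deriv i g x + partial_deriv i f x * g x"
proof -
  have "((\<lambda>x. f x * g x) has_derivative
      (\<lambda>v. f x * frechet_derivative g (at x) v + frechet_derivative f (at x) v * g x)) (at x)"
    using assms by (intro has_derivative_mult) (auto simp: frechet_derivative_works)
  from frechet_derivative_at[OF this] show ?thesis
    unfolding partial_deriv_def by metis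
qed

lemma measure_square: "measure lborel square = 1"
proof -
  have "(0 :: real^2) \<in> square" by (simp add: mem_box_cart)
  then show ?thesis
    using content_cbox_cart[of 0 "(\<chi> i. 1) :: real^2"] by fastforce
qed

interpretation dx: finite_measure dx
  by (rule finite_measureI)
    (simp add: dx_def emeasure_restrict_space space_restrict_space emeasure_lborel_cbox_eq)

lemma measure_space_dx: "measure dx (space dx) = 1"
  by (simp add: dx_def measure_restrict_space space_restrict_space measure_square)

lemma continuous_on_imp_borel_measurable_dx:
  "continuous_on square f \<Longrightarrow> f \<in> borel_measurable dx"
  for f :: "real^2 \<Rightarrow> complex"
  unfolding dx_def by (rule continuous_imp_measurable_on_sets_lebesgue) auto

lemma integrable_dx_continuous:
  "continuous_on square f \<Longrightarrow> integrable dx f" for f :: "real^2 \<Rightarrow> complex"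
  unfolding dx_def by (rule continuous_imp_integrable)

lemma LINT_dx_continuous:
  "continuous_on square f \<Longrightarrow> (LINT x|dx. f x) = integral square f" for f :: "real^2 \<Rightarrow> complex"
  using integrable_dx_continuous[of f] unfolding dx_def by (intro lebesgue_integral_eq_integral) auto

subsection \<open>Density of trigonometric polynomials\<close>

definition trig :: "(int \<times> int) set \<Rightarrow> (int \<times> int \<Rightarrow> complex) \<Rightarrow> real^2 \<Rightarrow> complex" where
  "trig C c x = (\<Sum>k\<in>C. c k * mode k x)"

text \<open>The inductive form makes closure under sums and products an easy induction;
  \<open>trig\<close>, with an explicit frequency set, is the form needed for computing
  integrals.\<close>

inductive trig_poly :: "(real^2 \<Rightarrow> complex) \<Rightarrow> bool" where
  monomial: "trig_poly (\<lambda>x. c * mode k x)"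
| add: "trig_poly f \<Longrightarrow> trig_poly g \<Longrightarrow> trig_poly (\<lambda>x. f x + g x)"

lemma trig_poly_cong: "(\<And>x. f x = g x) \<Longrightarrow> trig_poly g \<Longrightarrow> trig_poly f"
  by presburger

lemma trig_poly_const: "trig_poly (\<lambda>x. c)"
  using trig_poly.monomial[of c 0] by simp

lemma trig_poly_scale: "trig_poly f \<Longrightarrow> trig_poly (\<lambda>x. c * f x)"
  by (induction rule: trig_poly.induct)
    (auto simp: distrib_left mult.assoc [symmetric] intro: trig_poly.intros)

lemma trig_poly_times_mode: "trig_poly f \<Longrightarrow> trig_poly (\<lambda>x. f x * mode k x)"
  by (induction rule: trig_poly.induct)
    (auto simp: distrib_right mult.assoc mode_add [symmetric] intro: trig_poly.intros)

lemma trig_poly_mult: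
  assumes "trig_poly g" "trig_poly f"
  shows "trig_poly (\<lambda>x. f x * g x)"
  using assms
proof (induction rule: trig_poly.induct)
  case (monomial c k)
  then show ?case
    using trig_poly_scale[OF trig_poly_times_mode, of f c k] by (simp add: mult_ac)
next
  case (add g h)
  then show ?case by (auto simp: distrib_left intro: trig_poly.add)
qed

lemma trig_poly_imp_trig:
  assumes "trig_poly f"
  shows "\<exists>C c. finite C \<and> f = trig C c"
  using assms
proof (induction rule: trig_poly.induct)
  case (monomial c k)
  have "(\<lambda>x. c * mode k x) = trig {k} (\<lambda>_. c)"
    by (auto simp: trig_def)
  then show ?case by blast
next
  case (add f g)
  then obtain C c D d where *: "finite C" "f = trig C c" "finite D" "g = trig D d" by blast
  have "f x + g x = trig (C \<union> D) (\<lambda>k. (if k \<in> C then c k else 0) + (if k \<in> D then d k else 0)) x" for x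
  proof -
    have "f x = (\<Sum>k\<in>C \<union> D. (if k \<in> C then c k else 0) * mode k x)"
      "g x = (\<Sum>k\<in>C \<union> D. (if k \<in> D then d k else 0) * mode k x)"
      using * by (auto simp: trig_def intro!: sum.mono_neutral_cong_left)
    then show ?thesis
      by (simp add: trig_def distrib_right sum.distrib)
  qed
  then show ?case
    using * by (intro exI[of _ "C \<union> D"]) auto
qed

lemma continuous_on_trig [continuous_intros]: "continuous_on S (trig C c)"
  unfolding trig_def[abs_def] by (intro continuous_intros)

text \<open>A real-linear functional on pairs of complex numbers is a combination of the real and
  imaginary parts, and on the torus these are combinations of \<open>mode k\<close> and
  \<open>mode (- k)\<close>. Sums and products follow from the closure properties.\<close>

lemma trig_poly_real_polynomial:
  fixes p :: "complex \<times> complex \<Rightarrow> real"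
  assumes "real_polynomial_function p"
  shows "trig_poly (\<lambda>x. of_real (p (mode (1, 0) x, mode (0, 1) x)))"
  using assms
proof (induction rule: real_polynomial_function.induct)
  case (linear f)
  interpret bounded_linear f by fact
  have "complex_of_real (f (z, w)) = of_real (f (1, 0)) * ((z + cnj z) / 2) + of_real (f (\<i>, 0)) * ((z - cnj z) / (2 * \<i>))
    + of_real (f (0, 1)) * ((w + cnj w) / 2) + of_real (f (0, \<i>)) * ((w - cnj w) / (2 * \<i>))" for z w
  proof -
    have "(z, w) = Re z *\<^sub>R (1, 0) + Im z *\<^sub>R (\<i>, 0) + Re w *\<^sub>R (0, 1) + Im w *\<^sub>R (0, \<i>)"
      by (simp add: complex_eq_iff)
    then have "f (z, w) = Re z * f (1, 0) + Im z * f (\<i>, 0) + Re w * f (0, 1) + Im w * f (0, \<i>)"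
      by (simp only: add scale real_scaleR_def)
    moreover have "(u + cnj u) / 2 = of_real (Re u)" "(u - cnj u) / (2 * \<i>) = of_real (Im u)" for u
      by (auto simp: complex_eq_iff Re_divide Im_divide power2_eq_square)
    ultimately show ?thesis
      by (simp add: mult.commute)
  qed
  note eq = this
  have re: "trig_poly (\<lambda>x. (mode k x + cnj (mode k x)) / 2)" for k
    using trig_poly.add[OF trig_poly.monomial[of "1/2" k] trig_poly.monomial[of "1/2" "- k"]]
    by (simp add: cnj_mode add_divide_distrib)
  have im: "trig_poly (\<lambda>x. (mode k x - cnj (mode k x)) / (2 * \<i>))" for k
    by (rule trig_poly_cong[OF _ trig_poly_scale[OF trig_poly.add[OF trig_poly.monomial[of 1 k]
      trig_poly.monomial[of "-1" "- k"]], of "1 / (2 * \<i>)"]]) (simp add: cnj_mode)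
  show ?case
    by (rule trig_poly_cong[OF eq]) (intro trig_poly.add trig_poly_scale re im)
next
  case (const c)
  show ?case by (rule trig_poly_const)
qed (auto intro: trig_poly.add trig_poly_mult)

text \<open>The torus is realised as a product of two circles in \<open>C\<^sup>2\<close>; a function that vanishes on
  the boundary of the square factors through it.\<close>

lemma trig_poly_uniformly_dense:
  fixes g :: "real^2 \<Rightarrow> complex"
  assumes cont: "continuous_on square g" and zero: "\<And>x. x \<in> square \<Longrightarrow> x \<notin> box 0 (\<chi> i. 1) \<Longrightarrow> g x = 0"
    and "e > 0"
  shows "\<exists>p. trig_poly p \<and> (\<forall>x\<in>square. cmod (g x - p x) < e)"
proof -
  define T where "T x = (mode (1, 0) x, mode (0, 1) x)" for x
  define G where "G z = g (inv_into square T z)" for z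
  have contT: "continuous_on square T"
    unfolding T_def by (intro continuous_intros)
  \<comment> \<open>Distinct points of the square with the same image differ in some coordinate by a
    nonzero integer, so both lie on the boundary, where \<open>g\<close> is 0.\<close>
  have fiber: "g x = g y" if x: "x \<in> square" and y: "y \<in> square" and eq: "T x = T y" for x y
  proof (cases "x = y")
    case False
    have "\<exists>n::int. x $ i = y $ i + of_int n" for i
    proof -
      have "exp (\<i> * of_real (2 * pi * x $ i)) = exp (\<i> * of_real (2 * pi * y $ i))"
        using eq exhaust_2[of i] by (auto simp: T_def mode_def)
      then obtain n :: int where "\<i> * of_real (2 * pi * x $ i) = \<i> * of_real (2 * pi * y $ i) + of_int (2 * n) * pi * \<i>"
        unfolding exp_eq by blast
      then have "\<i> * of_real (2 * pi * x $ i) = \<i> * of_real (2 * pi * (y $ i + of_int n))"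
        by (simp add: algebra_simps)
      then have "2 * pi * x $ i = 2 * pi * (y $ i + of_int n)"
        by (metis mult_left_cancel complex_i_not_zero of_real_eq_iff)
      then have "x $ i = y $ i + of_int n" by simp
      then show ?thesis ..
    qed
    moreover obtain i where i: "x $ i \<noteq> y $ i"
      using False by (auto simp: vec_eq_iff)
    ultimately obtain n :: int where n: "x $ i = y $ i + of_int n" by blast
    have "0 \<le> x $ i" "x $ i \<le> 1" "0 \<le> y $ i" "y $ i \<le> 1"
      using x y by (auto simp: mem_box_cart)
    moreover have "n \<ge> 1 \<or> n \<le> -1"
      using n i by auto
    then have "real_of_int n \<ge> 1 \<or> real_of_int n \<le> -1"
      by linarith
    ultimately have "\<not> (0 < x $ i \<and> x $ i < 1)" "\<not> (0 < y $ i \<and> y $ i < 1)"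
      using n by auto
    then have "x \<notin> box 0 (\<chi> i. 1)" "y \<notin> box 0 (\<chi> i. 1)"
      by (auto simp: mem_box_cart)
    then show ?thesis using zero x y by simp
  qed simp
  have G: "G (T x) = g x" if "x \<in> square" for x
    unfolding G_def using that by (intro fiber) (auto intro: inv_into_into f_inv_into_f)
  have cK: "compact (T ` square)"
    by (intro compact_continuous_image contT) auto
  \<comment> \<open>By compactness \<open>T\<close> is a quotient map onto its image: the preimage
    under \<open>G\<close> of a closed set is the \<open>T\<close>-image of a compact set, hence
    closed.\<close>
  have contG: "continuous_on (T ` square) G"
    unfolding continuous_on_closed_vimage[OF compact_imp_closed[OF cK]]
  proof (intro allI impI)
    fix B :: "complex set" assume "closed B"
    then have "closed (g -` B \<inter> square)"
      using cont continuous_on_closed_vimage[of square g] by auto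
    then have "compact (square \<inter> (g -` B \<inter> square))"
      by (intro compact_Int_closed) auto
    moreover have "G -` B \<inter> T ` square = T ` (square \<inter> (g -` B \<inter> square))"
      using G by auto
    ultimately show "closed (G -` B \<inter> T ` square)"
      by (metis contT continuous_on_subset compact_continuous_image compact_imp_closed inf_le1)
  qed
  obtain P where P: "polynomial_function P" "\<And>z. z \<in> T ` square \<Longrightarrow> norm (G z - P z) < e"
    using Stone_Weierstrass_polynomial_function[OF cK contG \<open>e > 0\<close>] by metis
  have "real_polynomial_function (Re \<circ> P)" "real_polynomial_function (Im \<circ> P)"
    using P(1) bounded_linear_Re bounded_linear_Im unfolding polynomial_function_def by auto
  from this[THEN trig_poly_real_polynomial]
  have "trig_poly (\<lambda>x. of_real ((Re \<circ> P) (T x)) + \<i> * of_real ((Im \<circ> P) (T x)))"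
    unfolding T_def by (intro trig_poly.add trig_poly_scale)
  then have "trig_poly (\<lambda>x. P (T x))"
    by (simp add: complex_eq [symmetric])
  then show ?thesis
    using P(2) G by fastforce
qed

section \<open>Approximation in mean square\<close>

lemma integrable_dx_bounded:
  fixes f :: "real^2 \<Rightarrow> 'b::{banach, second_countable_topology}"
  assumes "f \<in> borel_measurable dx" "\<And>x. norm (f x) \<le> B"
  shows "integrable dx f"
  using assms by (intro dx.integrable_const_bound[of _ B]) auto

lemma negligible_imp_AE_dx: "negligible N \<Longrightarrow> AE x in dx. x \<notin> N"
  unfolding dx_def
  by (subst AE_restrict_space_iff) (auto simp: negligible_iff_null_sets intro: AE_not_in eventually_mono)

text \<open>Measurability provides continuous functions converging to \<open>f\<close> almost
  everywhere. They are clipped to the ball of radius \<open>M\<close>, so that dominated convergence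
  applies, and cut off at the boundary, so that the result descends to the torus.\<close>

lemma bounded_approx_continuous:
  fixes f :: "real^2 \<Rightarrow> complex"
  assumes f: "f \<in> borel_measurable dx" and M: "\<And>x. cmod (f x) \<le> M" and "e > 0"
  shows "\<exists>g. continuous_on square g \<and> (\<forall>x\<in>square. x \<notin> box 0 (\<chi> i. 1) \<longrightarrow> g x = 0) \<and>
    (\<forall>x. cmod (g x) \<le> M) \<and> (LINT x|dx. (cmod (f x - g x))\<^sup>2) < e"
proof -
  define Q where "Q = (box 0 (\<chi> i. 1) :: (real^2) set)"
  define M' where "M' = M + 1"
  have "M \<ge> 0" using M[of 0] norm_ge_zero order_trans by blast
  have "f measurable_on square"
    using f by (simp add: dx_def measurable_on_iff_borel_measurable)
  then obtain N g where N: "negligible N" and g: "\<And>n. continuous_on UNIV (g n)"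
    and lim: "\<And>x. x \<notin> N \<Longrightarrow> (\<lambda>n. g n x) \<longlonglongrightarrow> (if x \<in> square then f x else 0)"
    unfolding measurable_on_def by blast
  \<comment> \<open>The nearest-point projection onto a disc is continuous and fixes the values of
    \<open>f\<close>.\<close>
  define clip where "clip z = closest_point (cball 0 M) z" for z :: complex
  have ne: "cball 0 M \<noteq> ({} :: complex set)" using \<open>M \<ge> 0\<close> by auto
  have contclip: "continuous_on UNIV clip"
    unfolding clip_def by (intro continuous_on_closest_point ne) auto
  have clip_le: "cmod (clip z) \<le> M" for z
    using closest_point_in_set[OF closed_cball ne, of z] by (simp add: clip_def)
  have clip_id: "clip z = z" if "cmod z \<le> M" for z
    using that by (simp add: clip_def closest_point_self)
  \<comment> \<open>The cutoff vanishes off the open square and equals 1 at each interior point once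
    \<open>n\<close> is large.\<close>
  define h where "h n x = of_real (min 1 (real n * infdist x (- Q))) * clip (g n x)" for n x
  have conth: "continuous_on S (h n)" for n S
    unfolding h_def
    by (intro continuous_intros continuous_on_compose2[OF contclip] continuous_on_subset[OF g]) auto
  have fac: "\<bar>min 1 (real n * infdist x (- Q))\<bar> \<le> 1" for n x
    by (auto simp: min_def infdist_nonneg)
  have h_le: "cmod (h n x) \<le> M" for n x
    using mult_mono[OF fac[of n x] clip_le[of "g n x"]] by (simp add: h_def norm_mult)
  have h0: "h n x = 0" if "x \<notin> Q" for n x
    using that by (simp add: h_def)
  have limh: "(\<lambda>n. h n x) \<longlonglongrightarrow> f x" if "x \<in> Q" "x \<notin> N" for x
  proof -
    have "x \<in> square" using that box_subset_cbox by (auto simp: Q_def)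
    then have "(\<lambda>n. g n x) \<longlonglongrightarrow> f x"
      using lim[of x] that by simp
    then have "(\<lambda>n. clip (g n x)) \<longlonglongrightarrow> clip (f x)"
      using contclip by (intro isCont_tendsto_compose[of _ clip]) (auto simp: continuous_on_eq_continuous_at)
    then have 1: "(\<lambda>n. clip (g n x)) \<longlonglongrightarrow> f x"
      using M clip_id by simp
    have "infdist x (- Q) > 0"
    proof -
      have "x \<notin> closure (- Q)" using that by (simp add: Q_def closure_complement interior_open[OF open_box])
      \<comment> \<open>\<open>infdist\<close> to the empty set is 0 by convention, so
        \<open>- Q\<close> has to be seen to be nonempty.\<close>
      moreover have "0 \<in> - Q" by (simp add: Q_def mem_box_cart)
      ultimately show ?thesis
        by (metis in_closure_iff_infdist_zero infdist_nonneg empty_iff less_eq_real_def)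
    qed
    then have "eventually (\<lambda>n. real n * infdist x (- Q) \<ge> 1) sequentially"
      by real_asymp
    then have "eventually (\<lambda>n. clip (g n x) = h n x) sequentially"
      by eventually_elim (simp add: h_def)
    with 1 show ?thesis by (rule Lim_transform_eventually)
  qed
  note [measurable] = f continuous_on_imp_borel_measurable_dx[OF conth]
  have "(\<lambda>n. LINT x|dx. (cmod (f x - h n x))\<^sup>2) \<longlonglongrightarrow> (LINT x|dx. 0)"
  proof (rule integral_dominated_convergence[where w = "\<lambda>_. (2 * M)\<^sup>2"])
    have "negligible (N \<union> (square - Q))"
      using N negligible_frontier_interval by (auto simp: Q_def)
    from negligible_imp_AE_dx[OF this]
    have "AE x in dx. x \<in> space dx \<longrightarrow> x \<in> Q \<and> x \<notin> N"
      by eventually_elim (auto simp: dx_def)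
    then have "AE x in dx. x \<in> Q \<and> x \<notin> N"
      by (rule AE_mp) auto
    then show "AE x in dx. (\<lambda>n. (cmod (f x - h n x))\<^sup>2) \<longlonglongrightarrow> 0"
    proof eventually_elim
      case (elim x)
      then have "(\<lambda>n. (cmod (f x - h n x))\<^sup>2) \<longlonglongrightarrow> (cmod (f x - f x))\<^sup>2"
        by (intro tendsto_intros limh) auto
      then show ?case by simp
    qed
    show "AE x in dx. norm ((cmod (f x - h n x))\<^sup>2) \<le> (2 * M)\<^sup>2" for n
    proof (rule AE_I2)
      fix x
      have "cmod (f x - h n x) \<le> 2 * M"
        using norm_triangle_ineq4[of "f x" "h n x"] M[of x] h_le[of n x] by linarith
      then show "norm ((cmod (f x - h n x))\<^sup>2) \<le> (2 * M)\<^sup>2"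
        using power_mono[of "cmod (f x - h n x)" "2 * M" 2] by simp
    qed
  qed simp_all
  then have "eventually (\<lambda>n. (LINT x|dx. (cmod (f x - h n x))\<^sup>2) < e) sequentially"
    using \<open>e > 0\<close> by (intro order_tendstoD) auto
  then obtain n where "(LINT x|dx. (cmod (f x - h n x))\<^sup>2) < e"
    by (auto simp: eventually_sequentially)
  then show ?thesis
    using conth h0 h_le by (intro exI[of _ "h n"]) (auto simp: Q_def)
qed

lemma cmod_add3_square_le:
  "(cmod (a + b + c))\<^sup>2 \<le> 3 * (cmod a)\<^sup>2 + 3 * (cmod b)\<^sup>2 + 3 * (cmod c)\<^sup>2"
proof -
  have "(cmod (a + b + c))\<^sup>2 \<le> (cmod a + cmod b + cmod c)\<^sup>2"
    by (intro power_mono norm_triangle_mono norm_triangle_ineq) auto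
  also have "\<dots> \<le> 3 * (cmod a)\<^sup>2 + 3 * (cmod b)\<^sup>2 + 3 * (cmod c)\<^sup>2"
    using zero_le_power2[of "cmod a - cmod b"] zero_le_power2[of "cmod a - cmod c"]
      zero_le_power2[of "cmod b - cmod c"]
    by (simp add: power2_eq_square algebra_simps)
  finally show ?thesis .
qed

text \<open>Truncation, continuous approximation and uniform approximation are chained.
  Integrability is part of the conclusion because \<open>LINT\<close> is 0 by default on functions
  that are not integrable, so the bound alone would say nothing.\<close>

lemma trig_dense:
  fixes f :: "real^2 \<Rightarrow> complex"
  assumes f: "f \<in> borel_measurable dx" "integrable dx (\<lambda>x. (cmod (f x))\<^sup>2)" and "e > 0"
  shows "\<exists>C c. finite C \<and> integrable dx (\<lambda>x. (cmod (f x - trig C c x))\<^sup>2) \<and>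
    (LINT x|dx. (cmod (f x - trig C c x))\<^sup>2) < e"
proof -
  note [measurable] = f(1)
  \<comment> \<open>Three errors of size at most \<open>d\<close>, each with the weight 3 of
    \<open>cmod_add3_square_le\<close>, add up to \<open>9 * d\<close>.\<close>
  define d where "d = e / 9"
  have "d > 0" using \<open>e > 0\<close> by (simp add: d_def)
  define fn where "fn n x = (if cmod (f x) \<le> real n then f x else 0)" for n x
  have fn_meas [measurable]: "fn n \<in> borel_measurable dx" for n
    unfolding fn_def[abs_def] by measurable
  have fn_le: "cmod (f x - fn n x) \<le> cmod (f x)" "cmod (fn n x) \<le> real n" for n x
    by (auto simp: fn_def)
  have fn_int: "integrable dx (\<lambda>x. (cmod (f x - fn n x))\<^sup>2)" for n
    by (rule Bochner_Integration.integrable_bound[OF f(2)]) (auto intro!: power_mono fn_le)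
  have "(\<lambda>n. LINT x|dx. (cmod (f x - fn n x))\<^sup>2) \<longlonglongrightarrow> (LINT x|dx. 0)"
  proof (rule integral_dominated_convergence[OF _ _ f(2)])
    show "AE x in dx. (\<lambda>n. (cmod (f x - fn n x))\<^sup>2) \<longlonglongrightarrow> 0"
    proof (rule AE_I2)
      fix x
      obtain m :: nat where "cmod (f x) \<le> m" using real_arch_simple by blast
      then have "eventually (\<lambda>n. 0 = (cmod (f x - fn n x))\<^sup>2) sequentially"
        unfolding eventually_sequentially fn_def by (intro exI[of _ m]) auto
      then show "(\<lambda>n. (cmod (f x - fn n x))\<^sup>2) \<longlonglongrightarrow> 0"
        by (rule Lim_transform_eventually[OF tendsto_const])
    qed
  qed (auto intro!: power_mono fn_le)
  then have "eventually (\<lambda>n. (LINT x|dx. (cmod (f x - fn n x))\<^sup>2) < d) sequentially"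
    using \<open>d > 0\<close> by (intro order_tendstoD) auto
  then obtain n where n: "(LINT x|dx. (cmod (f x - fn n x))\<^sup>2) < d"
    by (auto simp: eventually_sequentially)
  obtain g where g: "continuous_on square g" "\<And>x. x \<in> square \<Longrightarrow> x \<notin> box 0 (\<chi> i. 1) \<Longrightarrow> g x = 0"
      "\<And>x. cmod (g x) \<le> real n" "(LINT x|dx. (cmod (fn n x - g x))\<^sup>2) < d"
    using bounded_approx_continuous[OF fn_meas fn_le(2) \<open>d > 0\<close>] by blast
  obtain p where p: "trig_poly p" "\<And>x. x \<in> square \<Longrightarrow> cmod (g x - p x) < sqrt d"
    using trig_poly_uniformly_dense[OF g(1,2), of "sqrt d"] \<open>d > 0\<close> by auto
  from trig_poly_imp_trig[OF p(1)] obtain C c where C: "finite C" "p = trig C c" by blast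
  have contp: "continuous_on square p"
    unfolding C by (intro continuous_intros)
  note [measurable] = continuous_on_imp_borel_measurable_dx[OF g(1)] continuous_on_imp_borel_measurable_dx[OF contp]
  have int2: "integrable dx (\<lambda>x. (cmod (fn n x - g x))\<^sup>2)"
  proof (rule integrable_dx_bounded[where B = "(real n + real n)\<^sup>2"])
    show "norm ((cmod (fn n x - g x))\<^sup>2) \<le> (real n + real n)\<^sup>2" for x
      using norm_triangle_ineq4[of "fn n x" "g x"] fn_le(2)[of n x] g(3)[of x]
        power_mono[of "cmod (fn n x - g x)" "real n + real n" 2] by simp
  qed simp
  have ae3: "AE x in dx. (cmod (g x - p x))\<^sup>2 \<le> d"
  proof (rule AE_I2)
    fix x assume "x \<in> space dx"
    then have "cmod (g x - p x) < sqrt d" using p(2) by (simp add: dx_def)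
    then have "(cmod (g x - p x))\<^sup>2 \<le> (sqrt d)\<^sup>2"
      by (intro power_mono) auto
    then show "(cmod (g x - p x))\<^sup>2 \<le> d" using \<open>d > 0\<close> by simp
  qed
  have int3: "integrable dx (\<lambda>x. (cmod (g x - p x))\<^sup>2)"
    using ae3 by (intro dx.integrable_const_bound[of _ d]) auto
  have "(LINT x|dx. (cmod (g x - p x))\<^sup>2) \<le> (LINT x|dx. d)"
    using ae3 by (intro integral_mono_AE int3) auto
  then have 3: "(LINT x|dx. (cmod (g x - p x))\<^sup>2) \<le> d"
    by (simp add: measure_space_dx)
  define B where "B x = 3 * (cmod (f x - fn n x))\<^sup>2 + 3 * (cmod (fn n x - g x))\<^sup>2 + 3 * (cmod (g x - p x))\<^sup>2" for x
  have intB: "integrable dx B"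
    unfolding B_def[abs_def] using fn_int int2 int3 by auto
  have le: "(cmod (f x - p x))\<^sup>2 \<le> B x" for x
    using cmod_add3_square_le[of "f x - fn n x" "fn n x - g x" "g x - p x"] by (simp add: B_def)
  have int: "integrable dx (\<lambda>x. (cmod (f x - p x))\<^sup>2)"
    using le by (intro Bochner_Integration.integrable_bound[OF intB]) (auto intro: order_trans[OF _ abs_ge_self])
  have "(LINT x|dx. (cmod (f x - p x))\<^sup>2) \<le> (LINT x|dx. B x)"
    using le by (intro integral_mono int intB) auto
  also have "\<dots> = 3 * (LINT x|dx. (cmod (f x - fn n x))\<^sup>2) + 3 * (LINT x|dx. (cmod (fn n x - g x))\<^sup>2)
    + 3 * (LINT x|dx. (cmod (g x - p x))\<^sup>2)"
    unfolding B_def using fn_int int2 int3 by simp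
  also have "\<dots> < 9 * d"
    using n g(4) 3 by linarith
  finally show ?thesis
    using int C by (auto simp: d_def)
qed

subsection \<open>Fourier coefficients and eigenfunctions\<close>

lemma periodic_partial_deriv:
  assumes "periodic f"
  shows "periodic (partial_deriv i f)"
  unfolding periodic_def
proof (intro allI impI)
  fix x v :: "real^2" assume "\<forall>i. v $ i \<in> \<int>"
  then have f: "f (y + v) = f y" for y
    using assms by (simp add: periodic_def)
  have "(f has_derivative D) (at (x + v)) \<longleftrightarrow> (f has_derivative D) (at x)" for D
  proof
    assume "(f has_derivative D) (at (x + v))"
    then have "((\<lambda>y. f (y + v)) has_derivative D) (at x)"
      by (rule has_derivative_compose[where f = "\<lambda>y. y + v" and f' = "\<lambda>y. y", rotated])
        (auto intro!: derivative_eq_intros)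
    then show "(f has_derivative D) (at x)" by (simp add: f)
  next
    assume *: "(f has_derivative D) (at x)"
    have "f (y - v) = f y" for y
      using f[of "y - v"] by simp
    moreover from * have "(f has_derivative D) (at ((x + v) - v))"
      by simp
    then have "((\<lambda>y. f (y - v)) has_derivative D) (at (x + v))"
      by (rule has_derivative_compose[where f = "\<lambda>y. y - v" and f' = "\<lambda>y. y", rotated])
        (auto intro!: derivative_eq_intros)
    ultimately show "(f has_derivative D) (at (x + v))" by simp
  qed
  then show "partial_deriv i f (x + v) = partial_deriv i f x"
    by (simp add: partial_deriv_def frechet_derivative_def)
qed

lemma periodic_mult: "periodic f \<Longrightarrow> periodic g \<Longrightarrow> periodic (\<lambda>x. f x * g x)"
  by (simp add: periodic_def)

text \<open>The derivative of the periodic product \<open>mode k x * f x\<close> has integral 0, and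
  the product rule splits it into the two terms.\<close>

lemma LINT_partial_deriv_mode:
  assumes per: "periodic f" and diff: "f differentiable_on UNIV"
    and cont: "continuous_on UNIV (partial_deriv i f)"
  shows "(LINT x|dx. mode k x * partial_deriv i f x) = - wave k i * (LINT x|dx. mode k x * f x)"
proof -
  have [continuous_intros]: "continuous_on S f" "continuous_on S (partial_deriv i f)" for S
    using differentiable_imp_continuous_on[OF diff] cont continuous_on_subset by blast+
  have eq: "partial_deriv i (\<lambda>x. mode k x * f x) x = mode k x * partial_deriv i f x + wave k i * (mode k x * f x)" for x
    using partial_deriv_mult[of "mode k" x f i] diff has_derivative_mode[of k x] partial_deriv_mode[of i 1 k]
    by (auto simp: differentiable_on_def differentiable_def mult.assoc)
  have "(\<lambda>x. mode k x * f x) differentiable_on UNIV"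
    using has_derivative_mode[of k] diff
    by (intro differentiable_on_mult) (auto simp: differentiable_on_def differentiable_def)
  then have "integral square (partial_deriv i (\<lambda>x. mode k x * f x)) = 0"
    by (intro integral_partial_deriv periodic_mult periodic_mode per)
      (auto simp: eq[abs_def] intro!: continuous_intros)
  also have "integral square (partial_deriv i (\<lambda>x. mode k x * f x)) =
      (LINT x|dx. mode k x * partial_deriv i f x + wave k i * (mode k x * f x))"
    unfolding eq[abs_def] by (subst LINT_dx_continuous) (auto intro!: continuous_intros)
  also have "\<dots> = (LINT x|dx. mode k x * partial_deriv i f x) + wave k i * (LINT x|dx. mode k x * f x)"
    by (subst Bochner_Integration.integral_add)
      (auto intro!: integrable_dx_continuous continuous_intros)
  finally show ?thesis
    by (simp add: add_eq_0_iff)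
qed

text \<open>For \<open>k \<noteq> 0\<close> some \<open>wave k i\<close> is nonzero, and integrating
  by parts against the constant 1 gives \<open>wave k i\<close> times the integral equal to
  0.\<close>

lemma LINT_mode: "(LINT x|dx. mode k x) = (if k = 0 then 1 else 0)"
proof (cases "k = 0")
  case True
  then show ?thesis by (simp add: measure_space_dx)
next
  case False
  then obtain i where i: "wave k i \<noteq> 0"
    by (cases "fst k = 0") (auto simp: wave_def prod_eq_iff intro: that[of 1] that[of 2])
  have "partial_deriv i (\<lambda>x. 1 :: complex) = (\<lambda>x. 0)"
    using partial_deriv_mode[of i 1 0] by (simp add: wave_def)
  then have "wave k i * (LINT x|dx. mode k x) = 0"
    using LINT_partial_deriv_mode[of "\<lambda>x. 1" i k] by (simp add: periodic_def)
  with i False show ?thesis by simp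
qed

text \<open>Two integrations by parts in each direction. This is the weak form of the eigenvalue
  equation for \<open>mode k\<close>.\<close>

lemma LINT_classical_laplacian_mode:
  assumes "smooth_periodic \<phi>"
  shows "(LINT x|dx. mode k x * classical_laplacian \<phi> x) =
    - of_real (4 * pi\<^sup>2 * of_int (normsq k)) * (LINT x|dx. mode k x * \<phi> x)"
proof -
  have C: "C_k 2 \<phi>" and per: "periodic \<phi>"
    using assms by (auto simp: smooth_periodic_def)
  then have diff: "\<phi> differentiable_on UNIV" "partial_deriv i \<phi> differentiable_on UNIV"
    and cont: "continuous_on UNIV (partial_deriv i (partial_deriv i \<phi>))" for i
    by (auto simp: numeral_2_eq_2)
  have *: "(LINT x|dx. mode k x * partial_deriv i (partial_deriv i \<phi>) x) = (wave k i)\<^sup>2 * (LINT x|dx. mode k x * \<phi> x)" for i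
    by (simp add: LINT_partial_deriv_mode[OF periodic_partial_deriv[OF per] diff(2) cont]
      LINT_partial_deriv_mode[OF per diff(1) differentiable_imp_continuous_on[OF diff(2)]] power2_eq_square)
  have "(LINT x|dx. mode k x * classical_laplacian \<phi> x) =
      (\<Sum>i\<in>UNIV. LINT x|dx. mode k x * partial_deriv i (partial_deriv i \<phi>) x)"
    unfolding classical_laplacian_def sum_distrib_left
    by (intro Bochner_Integration.integral_sum integrable_dx_continuous continuous_intros
        continuous_on_subset[OF cont]) auto
  also have "\<dots> = (\<Sum>i\<in>UNIV. (wave k i)\<^sup>2) * (LINT x|dx. mode k x * \<phi> x)"
    by (simp add: * sum_distrib_right)
  finally show ?thesis by (simp add: sum_wave)
qed

text \<open>Expanding the product gives modes of frequency \<open>k + l - j\<close>, of which only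
  \<open>j = k + l\<close> survives. With \<open>l = 0\<close> this is Parseval's identity; with
  equal factors it yields the Fourier coefficients of a squared modulus.\<close>

lemma LINT_mode_trig_trig:
  assumes [simp]: "finite C" "finite D"
  shows "(LINT x|dx. mode l x * (trig C c x * cnj (trig D d x))) =
    (\<Sum>k\<in>C. if k + l \<in> D then c k * cnj (d (k + l)) else 0)"
proof -
  have "mode l x * (trig C c x * cnj (trig D d x)) =
      (\<Sum>k\<in>C. \<Sum>j\<in>D. c k * cnj (d j) * mode (k + l - j) x)" for x
    unfolding trig_def cnj_sum sum_product unfolding sum_distrib_left
    by (intro sum.cong refl) (simp add: mode_add mode_diff mult_ac)
  then have "(LINT x|dx. mode l x * (trig C c x * cnj (trig D d x))) =
      (LINT x|dx. (\<Sum>k\<in>C. \<Sum>j\<in>D. c k * cnj (d j) * mode (k + l - j) x))"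
    by simp
  also have "\<dots> = (\<Sum>k\<in>C. \<Sum>j\<in>D. LINT x|dx. c k * cnj (d j) * mode (k + l - j) x)"
    by (subst Bochner_Integration.integral_sum Bochner_Integration.integral_sum
        | intro integrable_dx_continuous continuous_intros sum.cong refl)+
  also have "\<dots> = (\<Sum>k\<in>C. \<Sum>j\<in>D. if k + l = j then c k * cnj (d j) else 0)"
    by (intro sum.cong refl) (simp add: LINT_mode)
  also have "\<dots> = (\<Sum>k\<in>C. if k + l \<in> D then c k * cnj (d (k + l)) else 0)"
    by (intro sum.cong refl) (simp add: sum.delta' if_distrib cong: if_cong)
  finally show ?thesis .
qed

lemma square_integrable_trig: "square_integrable (trig C c)"
proof -
  have "periodic (trig C c)"
    using periodic_mode by (simp add: periodic_def trig_def)
  moreover have "integrable dx (\<lambda>x. complex_of_real ((cmod (trig C c x))\<^sup>2))"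
    by (intro integrable_dx_continuous continuous_intros)
  then have "integrable dx (\<lambda>x. Re (complex_of_real ((cmod (trig C c x))\<^sup>2)))"
    by (rule integrable_Re)
  ultimately show ?thesis
    by (simp add: square_integrable_def continuous_on_imp_borel_measurable_dx continuous_intros)
qed

lemma borel_measurable_cnj [measurable]: "cnj \<in> borel_measurable borel"
  by (intro borel_measurable_continuous_onI continuous_intros)

lemma integrable_dx_product:
  assumes "f \<in> borel_measurable dx" "integrable dx (\<lambda>x. (cmod (f x))\<^sup>2)"
    and "g \<in> borel_measurable dx" "integrable dx (\<lambda>x. (cmod (g x))\<^sup>2)"
  shows "integrable dx (\<lambda>x. f x * g x)"
proof -
  note [measurable] = assms(1,3)
  have le: "norm (z * w) \<le> norm ((cmod z)\<^sup>2 + (cmod w)\<^sup>2)" for z w :: complex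
  proof -
    have "0 \<le> cmod z * cmod w" by simp
    with sum_squares_bound[of "cmod z" "cmod w"] have "cmod z * cmod w \<le> (cmod z)\<^sup>2 + (cmod w)\<^sup>2"
      by (simp only: mult.assoc)
    then show ?thesis by (simp add: norm_mult)
  qed
  show ?thesis
    by (rule Bochner_Integration.integrable_bound[OF Bochner_Integration.integrable_add[OF assms(2,4)]])
      (use le in auto)
qed

text \<open>The inequality of arithmetic and geometric means replaces the Cauchy--Schwarz inequality.\<close>

lemma cmod_LINT_product_le:
  assumes f: "f \<in> borel_measurable dx" "integrable dx (\<lambda>x. (cmod (f x))\<^sup>2)"
    and g: "g \<in> borel_measurable dx" "integrable dx (\<lambda>x. (cmod (g x))\<^sup>2)" and "s > 0"
  shows "cmod (LINT x|dx. f x * g x) \<le>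
    (s * (LINT x|dx. (cmod (f x))\<^sup>2) + (LINT x|dx. (cmod (g x))\<^sup>2) / s) / 2"
proof -
  have le: "cmod z * cmod w \<le> (s * (cmod z)\<^sup>2 + (cmod w)\<^sup>2 / s) / 2" for z w
    using zero_le_power2[of "s * cmod z - cmod w"] \<open>s > 0\<close>
    by (simp add: power2_eq_square field_simps)
  have "cmod (LINT x|dx. f x * g x) \<le> (LINT x|dx. cmod (f x * g x))"
    by (rule integral_norm_bound)
  also have "\<dots> \<le> (LINT x|dx. (s * (cmod (f x))\<^sup>2 + (cmod (g x))\<^sup>2 / s) / 2)"
    using f g le by (intro integral_mono integrable_norm integrable_dx_product) (auto simp: norm_mult)
  also have "\<dots> = (s * (LINT x|dx. (cmod (f x))\<^sup>2) + (LINT x|dx. (cmod (g x))\<^sup>2) / s) / 2"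
    using f g by simp
  finally show ?thesis .
qed

text \<open>Completeness of the modes: \<open>f\<close> is orthogonal to every trigonometric
  polynomial \<open>p\<close>, so its squared norm \<open>I\<close> equals the pairing of
  \<open>f\<close> with \<open>f - p\<close>.\<close>

lemma LINT_mode_zero_imp_AE_zero:
  assumes f: "f \<in> borel_measurable dx" "integrable dx (\<lambda>x. (cmod (f x))\<^sup>2)"
    and zero: "\<And>k. (LINT x|dx. f x * cnj (mode k x)) = 0"
  shows "AE x in dx. f x = 0"
proof -
  note [measurable] = f(1)
  define I where "I = (LINT x|dx. (cmod (f x))\<^sup>2)"
  have "I \<le> e" if e: "e > 0" for e
  proof -
    obtain C c where C: "finite C" "integrable dx (\<lambda>x. (cmod (f x - trig C c x))\<^sup>2)"
        "(LINT x|dx. (cmod (f x - trig C c x))\<^sup>2) < e"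
      using trig_dense[OF f e] by blast
    define p where "p = trig C c"
    have p: "p \<in> borel_measurable dx" "integrable dx (\<lambda>x. (cmod (p x))\<^sup>2)"
      using square_integrable_trig by (auto simp: p_def square_integrable_def)
    note [measurable] = p(1)
    have m: "mode k \<in> borel_measurable dx" "integrable dx (\<lambda>x. (cmod (mode k x))\<^sup>2)" for k
      by (auto intro: continuous_on_imp_borel_measurable_dx continuous_intros)
    note [measurable] = m(1)
    have "(LINT x|dx. f x * cnj (p x)) = (LINT x|dx. (\<Sum>k\<in>C. cnj (c k) * (f x * cnj (mode k x))))"
      by (simp add: p_def trig_def sum_distrib_left mult_ac)
    also have "\<dots> = (\<Sum>k\<in>C. LINT x|dx. cnj (c k) * (f x * cnj (mode k x)))"
      using f m by (intro Bochner_Integration.integral_sum integrable_mult_right integrable_dx_product) auto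
    also have "\<dots> = 0" by (simp add: zero)
    finally have 0: "(LINT x|dx. f x * cnj (p x)) = 0" .
    have "of_real I = (LINT x|dx. f x * cnj (f x))"
      by (simp add: I_def complex_norm_square [symmetric] del: of_real_power)
    also have "\<dots> = (LINT x|dx. f x * cnj (f x)) - (LINT x|dx. f x * cnj (p x))"
      by (simp add: 0)
    also have "\<dots> = (LINT x|dx. f x * cnj (f x) - f x * cnj (p x))"
      using f p by (intro Bochner_Integration.integral_diff [symmetric] integrable_dx_product) auto
    also have "\<dots> = (LINT x|dx. f x * cnj (f x - p x))"
      by (simp add: right_diff_distrib)
    \<comment> \<open>With weight \<open>s = 1\<close> this reads
      \<open>I \<le> (I + e') / 2\<close> with \<open>e' < e\<close>, hence
      \<open>I \<le> e\<close>.\<close>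
    finally have "cmod (of_real I) \<le> (1 * I + (LINT x|dx. (cmod (cnj (f x - p x)))\<^sup>2) / 1) / 2"
      using cmod_LINT_product_le[of f "\<lambda>x. cnj (f x - p x)" 1] f C p
      by (simp add: I_def p_def flip: complex_cnj_diff)
    then show "I \<le> e"
      using C(3) by (simp add: p_def flip: complex_cnj_diff)
  qed
  then have "I \<le> 0" by (rule field_le_epsilon[of I 0, simplified])
  moreover have "I \<ge> 0" by (simp add: I_def)
  ultimately have "I = 0" by simp
  then have "AE x in dx. (cmod (f x))\<^sup>2 = 0"
    using integral_nonneg_eq_0_iff_AE[OF f(2)] by (simp add: I_def)
  then show ?thesis by simp
qed

section \<open>Fourier coefficients of elements of \<open>L2_torus\<close>\<close>

lift_definition fourier :: "(int \<times> int) set \<Rightarrow> (int \<times> int \<Rightarrow> complex) \<Rightarrow> L2_torus" is trig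
  by (simp add: ae_equal_def square_integrable_trig)

definition coef :: "L2_torus \<Rightarrow> int \<times> int \<Rightarrow> complex" where
  "coef u k = inner_L2 u (fourier {k} (\<lambda>_. 1))"

lemma L2_torus_cases:
  obtains f where "u = abs_L2_torus f" "square_integrable f" "ae_equal f f"
  by (induction u rule: L2_torus.abs_induct) (auto simp: ae_equal_def)

lemma coef_abs:
  assumes "square_integrable f"
  shows "coef (abs_L2_torus f) k = (LINT x|dx. f x * cnj (mode k x))"
  unfolding coef_def fourier.abs_eq
  using assms square_integrable_trig
  by (subst inner_L2.abs_eq) (auto simp: ae_equal_def trig_def)

lemma inner_fourier:
  assumes "finite C" "finite D"
  shows "inner_L2 (fourier C c) (fourier D d) = (\<Sum>k\<in>C \<inter> D. c k * cnj (d k))"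
proof -
  have "inner_L2 (fourier C c) (fourier D d) = (LINT x|dx. mode 0 x * (trig C c x * cnj (trig D d x)))"
    unfolding fourier.abs_eq using square_integrable_trig
    by (subst inner_L2.abs_eq) (auto simp: ae_equal_def)
  also have "\<dots> = (\<Sum>k\<in>C. if k \<in> D then c k * cnj (d k) else 0)"
    by (subst LINT_mode_trig_trig[OF assms]) (simp cong: if_cong)
  finally show ?thesis
    using assms by (simp add: sum.inter_restrict)
qed

lemma coef_fourier: "finite C \<Longrightarrow> coef (fourier C c) k = (if k \<in> C then c k else 0)"
  by (simp add: coef_def inner_fourier)

lemma coef_scale: "coef (scale_L2 a u) k = a * coef u k"
proof -
  obtain f where f: "u = abs_L2_torus f" "square_integrable f" "ae_equal f f"
    by (rule L2_torus_cases)
  then have "scale_L2 a u = abs_L2_torus (\<lambda>x. a * f x)"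
    by (simp add: scale_L2.abs_eq)
  then show ?thesis
    using f by (simp add: coef_abs square_integrable_scale mult.assoc)
qed

lemma coef_add: "coef (u + v) k = coef u k + coef v k"
proof -
  obtain f where f: "u = abs_L2_torus f" "square_integrable f" "ae_equal f f"
    by (rule L2_torus_cases)
  obtain g where g: "v = abs_L2_torus g" "square_integrable g" "ae_equal g g"
    by (rule L2_torus_cases)
  have [measurable]: "mode k \<in> borel_measurable dx"
    by (intro continuous_on_imp_borel_measurable_dx continuous_intros)
  have "u + v = abs_L2_torus (\<lambda>x. f x + g x)"
    using f g by (simp add: plus_L2_torus.abs_eq)
  moreover have "(LINT x|dx. (f x + g x) * cnj (mode k x)) =
      (LINT x|dx. f x * cnj (mode k x)) + (LINT x|dx. g x * cnj (mode k x))"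
    unfolding distrib_right using f g
    by (intro Bochner_Integration.integral_add integrable_dx_product) (auto simp: square_integrable_def)
  ultimately show ?thesis
    using f g by (simp add: coef_abs square_integrable_add)
qed

lemma coef_zero: "coef 0 k = 0"
  using coef_add[of 0 0 k] by simp

lemma coef_sum: "coef (\<Sum>i\<in>I. u i) k = (\<Sum>i\<in>I. coef (u i) k)"
  by (induction I rule: infinite_finite_induct) (auto simp: coef_zero coef_add)

lemma coef_zero_imp_zero:
  assumes "\<And>k. coef u k = 0"
  shows "u = 0"
proof -
  obtain f where f: "u = abs_L2_torus f" "square_integrable f" "ae_equal f f"
    by (rule L2_torus_cases)
  have "AE x in dx. f x = 0"
    using assms f by (intro LINT_mode_zero_imp_AE_zero) (auto simp: square_integrable_def coef_abs)
  then have "ae_equal f (\<lambda>x. 0)"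
    using f by (simp add: ae_equal_def square_integrable_zero)
  then show ?thesis
    unfolding f zero_L2_torus_def by (rule Quotient_rel_abs[OF Quotient_L2_torus])
qed

lemma coef_eqI:
  assumes "\<And>k. coef u k = coef v k"
  shows "u = v"
proof -
  have "coef (u - v) k = 0" for k
    using coef_add[of "u - v" v k] assms by simp
  then have "u - v = 0" by (rule coef_zero_imp_zero)
  then show ?thesis by simp
qed

text \<open>Through this lemma, completeness of the modes turns abstract eigenfunctions into
  trigonometric polynomials.\<close>

lemma fourier_coef:
  assumes "finite C" "\<And>k. k \<notin> C \<Longrightarrow> coef u k = 0"
  shows "u = fourier C (coef u)"
  using assms by (intro coef_eqI) (auto simp: coef_fourier)

text \<open>The distributional equation is tested with \<open>mode (- k)\<close>, the conjugate of
  \<open>mode k\<close>.\<close>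

lemma has_laplacian_coef:
  assumes "has_laplacian u v"
  shows "coef v k = - of_real (4 * pi\<^sup>2 * of_int (normsq k)) * coef u k"
proof -
  obtain f where f: "u = abs_L2_torus f" "square_integrable f" "ae_equal f f"
    by (rule L2_torus_cases)
  obtain g where g: "v = abs_L2_torus g" "square_integrable g" "ae_equal g g"
    by (rule L2_torus_cases)
  have "(LINT x|dx. f x * classical_laplacian (mode (- k)) x) = (LINT x|dx. g x * mode (- k) x)"
    using assms smooth_periodic_mode f g by (simp add: has_laplacian.abs_eq)
  moreover have "normsq (- k) = normsq k" by (simp add: normsq_def)
  then have "f x * classical_laplacian (mode (- k)) x =
      - of_real (4 * pi\<^sup>2 * of_int (normsq k)) * (f x * mode (- k) x)" for x
    by (simp add: classical_laplacian_mode)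
  ultimately show ?thesis
    using f g by (simp only: coef_abs cnj_mode integral_mult_right_zero)
qed

text \<open>Compare the coefficients at \<open>k\<close> in the eigenvalue equation. Since
  \<open>E\<close> determines \<open>normsq k\<close> for \<open>h \<noteq> 0\<close>, all
  frequencies of one eigenfunction lie on one circle.\<close>

lemma eigenfunction_coef:
  assumes "eigenfunction h E u" "coef u k \<noteq> 0"
  shows "E = 4 * pi\<^sup>2 * h\<^sup>2 * of_int (normsq k)"
proof -
  obtain v where v: "has_laplacian u v" "scale_L2 (of_real (- (h\<^sup>2))) v = scale_L2 (of_real E) u"
    using assms by (auto simp: eigenfunction_def)
  then have "of_real (- (h\<^sup>2)) * coef v k = of_real E * coef u k"
    by (metis coef_scale)
  then have "of_real (4 * pi\<^sup>2 * h\<^sup>2 * of_int (normsq k)) * coef u k = of_real E * coef u k"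
    by (simp add: has_laplacian_coef[OF v(1)] mult_ac)
  then have "complex_of_real (4 * pi\<^sup>2 * h\<^sup>2 * of_int (normsq k)) = of_real E"
    using assms(2) by (metis mult_right_cancel)
  then show ?thesis
    using of_real_eq_iff by metis
qed

lemma eigenfunction_mode: "eigenfunction h (4 * pi\<^sup>2 * h\<^sup>2 * of_int (normsq k)) (fourier {k} (\<lambda>_. 1))"
proof -
  define z where "z = complex_of_real (4 * pi\<^sup>2 * of_int (normsq k))"
  have "has_laplacian (fourier {k} (\<lambda>_. 1)) (fourier {k} (\<lambda>_. - z))"
    unfolding fourier.abs_eq using square_integrable_trig LINT_classical_laplacian_mode
    by (subst has_laplacian.abs_eq) (auto simp: ae_equal_def trig_def z_def mult.assoc)
  moreover have "scale_L2 (of_real (- (h\<^sup>2))) (fourier {k} (\<lambda>_. - z)) =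
      scale_L2 (of_real (4 * pi\<^sup>2 * h\<^sup>2 * of_int (normsq k))) (fourier {k} (\<lambda>_. 1))"
    by (rule coef_eqI) (simp only: coef_scale, simp add: coef_fourier z_def mult_ac)
  moreover have "coef (fourier {k} (\<lambda>_. 1)) k \<noteq> coef 0 k"
    by (simp add: coef_fourier coef_zero)
  then have "fourier {k} (\<lambda>_. 1) \<noteq> 0" by metis
  ultimately show ?thesis
    unfolding eigenfunction_def by blast
qed

subsection \<open>Lattice points on circles, lines and annuli\<close>

text \<open>For integers \<open>0 \<le> a \<le> s\<close>,
  \<open>(s - a)^2 \<le> s^2 - a^2 \<le> Q - P\<close>, so the absolute values fill an interval of
  length at most \<open>sqrt (Q - P)\<close> above the smallest one; the factor 2 is for the signs.
  The bound does not depend on where the window lies.\<close>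

lemma card_square_window:
  fixes F :: "int set" and P Q :: real
  assumes PQ: "P \<le> Q" and F: "finite F" "\<And>s. s \<in> F \<Longrightarrow> P \<le> (of_int s)\<^sup>2" "\<And>s. s \<in> F \<Longrightarrow> (of_int s)\<^sup>2 \<le> Q"
  shows "real (card F) \<le> 2 * (1 + sqrt (Q - P))"
proof (cases "F = {}")
  case True
  then show ?thesis using PQ by simp
next
  case False
  define A where "A = abs ` F"
  define a where "a = Min A"
  define D where "D = \<lfloor>sqrt (Q - P)\<rfloor>"
  have A: "finite A" "A \<noteq> {}" using F False by (auto simp: A_def)
  have "A \<subseteq> {a..a + D}"
  proof
    fix s assume s: "s \<in> A"
    have a: "a \<in> A" "a \<le> s" using A s by (auto simp: a_def)
    then have "0 \<le> a" by (auto simp: A_def)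
    have "P \<le> (of_int a)\<^sup>2" "(of_int s)\<^sup>2 \<le> Q"
      using F(2,3) a(1) s by (auto simp: A_def)
    moreover have "(s - a)\<^sup>2 \<le> s\<^sup>2 - a\<^sup>2"
      using mult_left_mono[OF a(2) \<open>0 \<le> a\<close>] by (simp add: power2_eq_square algebra_simps)
    then have "real_of_int ((s - a)\<^sup>2) \<le> real_of_int (s\<^sup>2 - a\<^sup>2)" by (simp only: of_int_le_iff)
    ultimately have "(real_of_int (s - a))\<^sup>2 \<le> Q - P" by simp
    then have "real_of_int (s - a) \<le> sqrt (Q - P)"
      by (rule real_le_rsqrt)
    then have "s - a \<le> D" by (simp add: D_def le_floor_iff)
    with a show "s \<in> {a..a + D}" by auto
  qed
  then have "card A \<le> card {a..a + D}" by (intro card_mono) auto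
  also have "\<dots> = nat (D + 1)" by simp
  finally have "card A \<le> nat (D + 1)" .
  moreover have "D \<ge> 0" using PQ by (simp add: D_def)
  ultimately have "real (card A) \<le> real_of_int (D + 1)" by linarith
  also have "\<dots> \<le> 1 + sqrt (Q - P)" by (simp add: D_def)
  finally have cA: "real (card A) \<le> 1 + sqrt (Q - P)" .
  have "F \<subseteq> A \<union> uminus ` A"
  proof
    fix s assume "s \<in> F"
    then have "\<bar>s\<bar> \<in> A" by (simp add: A_def)
    then show "s \<in> A \<union> uminus ` A"
      by (cases "s \<ge> 0") (auto intro: rev_image_eqI)
  qed
  then have "card F \<le> card (A \<union> uminus ` A)" using A by (intro card_mono) auto
  also have "\<dots> \<le> card A + card (uminus ` A)" by (rule card_Un_le)
  also have "card (uminus ` A) = card A" by (rule card_image) auto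
  finally have "real (card F) \<le> 2 * real (card A)" by simp
  then show ?thesis using cA by argo
qed

text \<open>On a line, a lattice point is determined by its component along the line, and the norm
  window becomes a window for the square of that component.\<close>

lemma card_lattice_line:
  fixes F :: "(int \<times> int) set" and P Q :: real
  assumes "finite F" "l \<noteq> 0" and PQ: "P \<le> Q"
    and line: "\<And>k. k \<in> F \<Longrightarrow> 2 * (fst k * fst l + snd k * snd l) = t"
    and window: "\<And>k. k \<in> F \<Longrightarrow> P \<le> normsq k" "\<And>k. k \<in> F \<Longrightarrow> normsq k \<le> Q"
  shows "real (card F) \<le> 2 * (1 + sqrt ((Q - P) * normsq l))"
proof -
  \<comment> \<open>The cross product with \<open>l\<close> measures the position along the line,
    which is perpendicular to \<open>l\<close>. By Lagrange's identity
    \<open>normsq k * normsq l = t^2 / 4 + (g k)^2\<close>, so the window is scaled by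
    \<open>normsq l\<close> and shifted.\<close>
  define g where "g k = fst k * snd l - snd k * fst l" for k :: "int \<times> int"
  have l: "normsq l > 0"
    using \<open>l \<noteq> 0\<close> by (simp add: normsq_def prod_eq_iff sum_power2_gt_zero_iff)
  have lagrange: "normsq k * normsq l = (fst k * fst l + snd k * snd l)\<^sup>2 + (g k)\<^sup>2" for k
    by (simp add: normsq_def g_def power2_eq_square algebra_simps)
  have "inj_on g F"
  proof (rule inj_onI)
    fix j k assume jk: "j \<in> F" "k \<in> F" "g j = g k"
    have "fst j * fst l + snd j * snd l = fst k * fst l + snd k * snd l"
      using trans[OF line[OF jk(1)] line[OF jk(2), symmetric]] by simp
    then have "fst (j - k) * fst l + snd (j - k) * snd l = 0"
      by (simp add: algebra_simps)
    moreover have "g (j - k) = 0"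
      using jk by (simp add: g_def algebra_simps)
    ultimately have "normsq (j - k) * normsq l = 0"
      by (simp add: lagrange)
    then have "normsq (j - k) = 0" using l by simp
    then show "j = k"
      by (simp add: normsq_def prod_eq_iff sum_power2_eq_zero_iff)
  qed
  then have "card F = card (g ` F)" by (simp add: card_image)
  also have "real \<dots> \<le> 2 * (1 + sqrt ((Q * normsq l - t\<^sup>2 / 4) - (P * normsq l - t\<^sup>2 / 4)))"
  proof (rule card_square_window)
    have g2: "(of_int (g k))\<^sup>2 = real_of_int (normsq k) * normsq l - t\<^sup>2 / 4" if "k \<in> F" for k
    proof -
      have "4 * (normsq k * normsq l) = t\<^sup>2 + 4 * (g k)\<^sup>2"
        unfolding lagrange line[OF that, symmetric] by (simp add: power2_eq_square algebra_simps)
      then have "real_of_int (4 * (normsq k * normsq l)) = real_of_int (t\<^sup>2 + 4 * (g k)\<^sup>2)"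
        by (simp only:)
      then show ?thesis by simp
    qed
    show "P * normsq l - t\<^sup>2 / 4 \<le> (of_int s)\<^sup>2" if "s \<in> g ` F" for s
      using that window(1) l g2 by (auto intro!: mult_right_mono)
    show "(of_int s)\<^sup>2 \<le> Q * normsq l - t\<^sup>2 / 4" if "s \<in> g ` F" for s
      using that window(2) l g2 by (auto intro!: mult_right_mono)
  qed (use \<open>finite F\<close> PQ l in \<open>auto intro!: mult_right_mono\<close>)
  finally show ?thesis by (simp add: left_diff_distrib)
qed

lemma normsq_add: "normsq (k + l) = normsq k + 2 * (fst k * fst l + snd k * snd l) + normsq l"
  by (simp add: normsq_def power2_eq_square algebra_simps)

text \<open>Equal norms of \<open>k\<close> and \<open>k + l\<close> put \<open>k\<close> on a line,
  and the window degenerates to \<open>P = Q = m\<close>: a line meets a circle at most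
  twice.\<close>

lemma card_circle_translate:
  assumes "finite F" "l \<noteq> 0" "\<And>k. k \<in> F \<Longrightarrow> normsq k = m" "\<And>k. k \<in> F \<Longrightarrow> normsq (k + l) = m"
  shows "card F \<le> 2"
proof -
  have "real (card F) \<le> 2 * (1 + sqrt ((real_of_int m - real_of_int m) * normsq l))"
  proof (rule card_lattice_line[where t = "- normsq l"])
    show "2 * (fst k * fst l + snd k * snd l) = - normsq l" if "k \<in> F" for k
      using assms(3,4)[OF that] by (simp add: normsq_add)
  qed (use assms in auto)
  then show ?thesis by simp
qed

section \<open>Fourier coefficients of squared moduli\<close>

definition corr :: "(int \<times> int) set \<Rightarrow> (int \<times> int \<Rightarrow> complex) \<Rightarrow> int \<times> int \<Rightarrow> complex" where
  "corr S c l = (\<Sum>k\<in>S. if k + l \<in> S then c k * cnj (c (k + l)) else 0)"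

lemma of_real_cmod_square: "complex_of_real ((cmod z)\<^sup>2) = z * cnj z"
  by (rule complex_norm_square)

text \<open>Thus \<open>corr S c l\<close> is the Fourier coefficient of the squared modulus at
  \<open>- l\<close>, since \<open>mode l\<close> enters without conjugation.\<close>

lemma LINT_mode_trig_square:
  "finite S \<Longrightarrow> (LINT x|dx. mode l x * of_real ((cmod (trig S c x))\<^sup>2)) = corr S c l"
  unfolding of_real_cmod_square corr_def by (rule LINT_mode_trig_trig)

lemma corr_zero: "finite S \<Longrightarrow> corr S c 0 = of_real (\<Sum>k\<in>S. (cmod (c k))\<^sup>2)"
  unfolding corr_def of_real_sum of_real_cmod_square by (intro sum.cong) auto

text \<open>For fixed \<open>k\<close>, \<open>j = k - l\<close> is a bijection between the
  admissible differences \<open>l\<close> and the elements \<open>j\<close> of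
  \<open>S\<close>.\<close>

lemma sum_differences:
  fixes f :: "'a::ab_group_add \<Rightarrow> 'a \<Rightarrow> 'b::comm_monoid_add"
  assumes "finite S"
  shows "(\<Sum>l\<in>(\<lambda>(j, k). j - k) ` (S \<times> S). \<Sum>k\<in>S. if k - l \<in> S then f k (k - l) else 0) =
    (\<Sum>k\<in>S. \<Sum>j\<in>S. f k j)"
proof -
  define D where "D = (\<lambda>(j, k). j - k) ` (S \<times> S)"
  have D: "finite D" using assms by (simp add: D_def)
  have "(\<Sum>l\<in>D. if k - l \<in> S then f k (k - l) else 0) = (\<Sum>j\<in>S. f k j)" if "k \<in> S" for k
  proof -
    have "(\<Sum>l\<in>D. if k - l \<in> S then f k (k - l) else 0) = (\<Sum>l\<in>{l\<in>D. k - l \<in> S}. f k (k - l))"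
      using D by (simp add: sum.inter_filter)
    also have "k - j \<in> D" if "j \<in> S" for j
      using that \<open>k \<in> S\<close> by (auto simp: D_def)
    then have "(\<Sum>l\<in>{l\<in>D. k - l \<in> S}. f k (k - l)) = (\<Sum>j\<in>S. f k j)"
      by (intro sum.reindex_bij_witness[where i = "\<lambda>j. k - j" and j = "\<lambda>l. k - l"]) auto
    finally show ?thesis .
  qed
  then show ?thesis
    unfolding D_def [symmetric] by (subst sum.swap) (simp cong: sum.cong)
qed

text \<open>Zygmund's \<open>L\<^sup>4\<close> bound: a translate of a circle meets the circle in at most two points.\<close>

lemma LINT_trig_fourth_power_le:
  assumes S: "finite S" and circle: "\<And>k. k \<in> S \<Longrightarrow> c k \<noteq> 0 \<Longrightarrow> normsq k = m"
    and norm: "(\<Sum>k\<in>S. (cmod (c k))\<^sup>2) = 1"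
  shows "(LINT x|dx. ((cmod (trig S c x))\<^sup>2)\<^sup>2) \<le> 3"
proof -
  define D where "D = (\<lambda>(j, k). j - k) ` (S \<times> S)"
  define b where "b l = corr S c (- l)" for l
  have D: "finite D" using S by (simp add: D_def)
  have "complex_of_real ((cmod (trig S c x))\<^sup>2) = trig D b x" for x
  proof -
    have "complex_of_real ((cmod (trig S c x))\<^sup>2) =
        (\<Sum>k\<in>S. \<Sum>j\<in>S. c k * cnj (c j) * mode (k - j) x)"
      unfolding of_real_cmod_square trig_def cnj_sum sum_product
      by (intro sum.cong refl) (simp add: mode_diff mult_ac)
    also have "\<dots> = (\<Sum>l\<in>D. \<Sum>k\<in>S. if k - l \<in> S then c k * cnj (c (k - l)) * mode (k - (k - l)) x else 0)"
      unfolding D_def by (rule sum_differences [OF S, symmetric])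
    also have "\<dots> = trig D b x"
      by (auto simp: trig_def b_def corr_def sum_distrib_right intro!: sum.cong)
    finally show ?thesis .
  qed
  then have eq: "complex_of_real (((cmod (trig S c x))\<^sup>2)\<^sup>2) = mode 0 x * (trig D b x * cnj (trig D b x))" for x
    by (metis of_real_cmod_square mode_zero mult_1 norm_of_real power2_abs)
  have "complex_of_real (LINT x|dx. ((cmod (trig S c x))\<^sup>2)\<^sup>2) = (LINT x|dx. mode 0 x * (trig D b x * cnj (trig D b x)))"
    by (simp only: eq [symmetric] integral_complex_of_real)
  also have "\<dots> = (\<Sum>l\<in>D. b l * cnj (b l))"
    by (subst LINT_mode_trig_trig[OF D D]) (simp cong: if_cong sum.cong)
  also have "\<dots> = of_real (\<Sum>l\<in>D. (cmod (b l))\<^sup>2)"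
    by (simp add: of_real_cmod_square [symmetric] del: of_real_power)
  finally have "(LINT x|dx. ((cmod (trig S c x))\<^sup>2)\<^sup>2) = (\<Sum>l\<in>D. (cmod (b l))\<^sup>2)"
    by (simp only: of_real_eq_iff)
  \<comment> \<open>The coefficient at 0 contributes 1. Summed over \<open>l\<close>, the products
    run over all pairs and give the square of the norm, so the total is at most
    \<open>1 + 2 * 1\<close>.\<close>
  also have "\<dots> \<le> (\<Sum>l\<in>D. (if l = 0 then 1 else 0) +
      2 * (\<Sum>k\<in>S. if k - l \<in> S then (cmod (c k))\<^sup>2 * (cmod (c (k - l)))\<^sup>2 else 0))"
  proof (rule sum_mono)
    fix l
    define G where "G = (\<Sum>k\<in>S. if k - l \<in> S then (cmod (c k))\<^sup>2 * (cmod (c (k - l)))\<^sup>2 else 0)"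
    have G: "G \<ge> 0" unfolding G_def by (intro sum_nonneg) auto
    show "(cmod (b l))\<^sup>2 \<le> (if l = 0 then 1 else 0) + 2 * G"
    proof (cases "l = 0")
      case True
      then have "b l = 1" using corr_zero[OF S, of c] norm by (simp add: b_def)
      then show ?thesis using True G by simp
    next
      case False
      \<comment> \<open>Only pairs with both coefficients nonzero matter, and they lie on the
        circle. There are at most two, so the Cauchy--Schwarz inequality costs only a factor
        2.\<close>
      define F where "F = {k \<in> S. k - l \<in> S \<and> c k \<noteq> 0 \<and> c (k - l) \<noteq> 0}"
      have F: "finite F" using S by (simp add: F_def)
      have card: "card F \<le> 2"
        using False circle by (intro card_circle_translate[OF F, of "- l" m]) (auto simp: F_def)
      have "b l = (\<Sum>k\<in>F. c k * cnj (c (k - l)))"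
        unfolding b_def corr_def F_def using S by (intro sum.mono_neutral_cong_right) auto
      then have "cmod (b l) \<le> (\<Sum>k\<in>F. cmod (c k) * cmod (c (k - l)))"
        using norm_sum[of "\<lambda>k. c k * cnj (c (k - l))" F] by (simp add: norm_mult)
      then have "(cmod (b l))\<^sup>2 \<le> (\<Sum>k\<in>F. cmod (c k) * cmod (c (k - l)))\<^sup>2"
        by (intro power_mono) auto
      also have "\<dots> \<le> (\<Sum>k\<in>F. (cmod (c k) * cmod (c (k - l)))\<^sup>2) * card F"
        by (rule sum_squared_le_sum_of_squares)
      also have "\<dots> \<le> (\<Sum>k\<in>F. (cmod (c k) * cmod (c (k - l)))\<^sup>2) * 2"
        using card by (intro mult_left_mono sum_nonneg) auto
      also have "(\<Sum>k\<in>F. (cmod (c k) * cmod (c (k - l)))\<^sup>2) = G"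
        unfolding G_def F_def using S
        by (intro sum.mono_neutral_cong_left) (auto simp: power_mult_distrib)
      finally show ?thesis using False by simp
    qed
  qed
  also have "\<dots> = (\<Sum>l\<in>D. if l = 0 then 1 else 0) + 2 * (\<Sum>k\<in>S. \<Sum>j\<in>S. (cmod (c k))\<^sup>2 * (cmod (c j))\<^sup>2)"
    unfolding D_def sum.distrib sum_distrib_left [symmetric]
    by (subst sum_differences[OF S, where f = "\<lambda>k j. (cmod (c k))\<^sup>2 * (cmod (c j))\<^sup>2"])
      (simp only: sum_distrib_left)
  also have "(\<Sum>k\<in>S. \<Sum>j\<in>S. (cmod (c k))\<^sup>2 * (cmod (c j))\<^sup>2) = 1"
    by (simp only: sum_distrib_left [symmetric] norm mult_1_right)
  also have "(\<Sum>l\<in>D. if l = 0 then 1 else 0) \<le> (1::real)"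
    using D by (simp add: sum.delta')
  finally show ?thesis by simp
qed

text \<open>Bessel's inequality for the unit vector at \<open>k\<close>: its projection
  \<open>v\<close> onto the span of the rows has squared norm \<open>s\<close> and entry
  \<open>s\<close> at \<open>k\<close>, whence \<open>s * s \<le> s\<close>.\<close>

lemma orthonormal_rows_imp_column_le:
  fixes c :: "'j \<Rightarrow> 'k \<Rightarrow> complex"
  assumes "finite J" "finite S" "k \<in> S"
    and orth: "\<And>i j. i \<in> J \<Longrightarrow> j \<in> J \<Longrightarrow> (\<Sum>k\<in>S. c i k * cnj (c j k)) = (if i = j then 1 else 0)"
  shows "(\<Sum>j\<in>J. (cmod (c j k))\<^sup>2) \<le> 1"
proof -
  define s where "s = (\<Sum>j\<in>J. (cmod (c j k))\<^sup>2)"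
  define v where "v k' = (\<Sum>j\<in>J. cnj (c j k) * c j k')" for k'
  have s0: "s \<ge> 0" unfolding s_def by (intro sum_nonneg) auto
  have vk: "v k = of_real s"
    by (simp add: v_def s_def of_real_cmod_square mult.commute del: of_real_power)
  have "complex_of_real (\<Sum>k'\<in>S. (cmod (v k'))\<^sup>2) =
      (\<Sum>k'\<in>S. \<Sum>i\<in>J. \<Sum>j\<in>J. (cnj (c i k) * c j k) * (c i k' * cnj (c j k')))"
    by (simp add: of_real_cmod_square v_def sum_product mult_ac del: of_real_power)
  also have "\<dots> = (\<Sum>i\<in>J. \<Sum>j\<in>J. (cnj (c i k) * c j k) * (\<Sum>k'\<in>S. c i k' * cnj (c j k')))"
    unfolding sum_distrib_left
    by (subst sum.swap) (rule sum.cong[OF refl], rule sum.swap)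
  also have "\<dots> = (\<Sum>i\<in>J. \<Sum>j\<in>J. if i = j then cnj (c i k) * c j k else 0)"
    by (intro sum.cong refl) (simp add: orth)
  also have "\<dots> = of_real s"
    using assms(1) by (simp add: s_def of_real_cmod_square mult.commute del: of_real_power)
  finally have "(\<Sum>k'\<in>S. (cmod (v k'))\<^sup>2) = s"
    by (simp only: of_real_eq_iff)
  moreover have "(cmod (v k))\<^sup>2 \<le> (\<Sum>k'\<in>S. (cmod (v k'))\<^sup>2)"
    using assms by (intro member_le_sum) auto
  ultimately have "s * s \<le> s"
    using vk s0 by (simp add: power2_eq_square)
  then have "s \<le> 1"
    using s0 mult_le_cancel_left_pos[of s s 1] by (cases "s = 0") auto
  then show ?thesis by (simp add: s_def)
qed

text \<open>Each row lives on one circle, so only pairs of equal norm contribute, whatever the row.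
  The arithmetic-geometric mean inequality splits each product, and after exchanging the sums every
  \<open>k\<close> costs at most two halves of a column sum.\<close>

lemma sum_corr_le:
  fixes c :: "'j \<Rightarrow> int \<times> int \<Rightarrow> complex"
  assumes S: "finite S" and J: "finite J"
    and circle: "\<And>j k. j \<in> J \<Longrightarrow> k \<in> S \<Longrightarrow> c j k \<noteq> 0 \<Longrightarrow> normsq k = m j"
    and col: "\<And>k. k \<in> S \<Longrightarrow> (\<Sum>j\<in>J. (cmod (c j k))\<^sup>2) \<le> 1"
  shows "(\<Sum>j\<in>J. cmod (corr S (c j) l)) \<le> card {k \<in> S. k + l \<in> S \<and> normsq (k + l) = normsq k}"
proof -
  define F where "F = {k \<in> S. k + l \<in> S \<and> normsq (k + l) = normsq k}"
  have F: "finite F" using S by (simp add: F_def)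
  have "cmod (corr S (c j) l) \<le> (\<Sum>k\<in>F. ((cmod (c j k))\<^sup>2 + (cmod (c j (k + l)))\<^sup>2) / 2)" if "j \<in> J" for j
  proof -
    have "c j k = 0 \<or> c j (k + l) = 0" if "k \<in> S" "k + l \<in> S" "k \<notin> F" for k
      using circle[OF \<open>j \<in> J\<close>, of k] circle[OF \<open>j \<in> J\<close>, of "k + l"] that
      by (cases "c j k = 0"; cases "c j (k + l) = 0") (auto simp: F_def)
    then have "corr S (c j) l = (\<Sum>k\<in>F. c j k * cnj (c j (k + l)))"
      unfolding corr_def using S by (intro sum.mono_neutral_cong_right) (auto simp: F_def)
    also have "cmod \<dots> \<le> (\<Sum>k\<in>F. ((cmod (c j k))\<^sup>2 + (cmod (c j (k + l)))\<^sup>2) / 2)"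
    proof (rule sum_norm_le)
      fix k
      show "cmod (c j k * cnj (c j (k + l))) \<le> ((cmod (c j k))\<^sup>2 + (cmod (c j (k + l)))\<^sup>2) / 2"
        using sum_squares_bound[of "cmod (c j k)" "cmod (c j (k + l))"] by (simp add: norm_mult)
    qed
    finally show ?thesis .
  qed
  then have "(\<Sum>j\<in>J. cmod (corr S (c j) l)) \<le> (\<Sum>j\<in>J. \<Sum>k\<in>F. ((cmod (c j k))\<^sup>2 + (cmod (c j (k + l)))\<^sup>2) / 2)"
    by (rule sum_mono)
  also have "\<dots> = (\<Sum>k\<in>F. ((\<Sum>j\<in>J. (cmod (c j k))\<^sup>2) + (\<Sum>j\<in>J. (cmod (c j (k + l)))\<^sup>2)) / 2)"
    by (subst sum.swap) (simp add: sum.distrib sum_divide_distrib [symmetric])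
  also have "\<dots> \<le> (\<Sum>k\<in>F. 1)"
  proof (rule sum_mono)
    fix k assume "k \<in> F"
    then have "(\<Sum>j\<in>J. (cmod (c j k))\<^sup>2) \<le> 1" "(\<Sum>j\<in>J. (cmod (c j (k + l)))\<^sup>2) \<le> 1"
      by (auto simp: F_def intro!: col)
    then show "((\<Sum>j\<in>J. (cmod (c j k))\<^sup>2) + (\<Sum>j\<in>J. (cmod (c j (k + l)))\<^sup>2)) / 2 \<le> 1" by simp
  qed
  finally show ?thesis by (simp add: F_def)
qed

text \<open>For \<open>x\<close> close to the radius \<open>T\<close>, the section of the annulus over \<open>x\<close> is so long that it
  contains the lattice point whose second coordinate is the floor of \<open>sqrt (T\<^sup>2 - x\<^sup>2)\<close>.\<close>

lemma card_annulus_ge: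
  fixes S :: "(int \<times> int) set" and T B :: real
  assumes S: "finite S" "\<And>k. T\<^sup>2 - 2 * B \<le> normsq k \<Longrightarrow> normsq k \<le> T\<^sup>2 \<Longrightarrow> k \<in> S"
    and T: "T > 0" and B: "B > 0"
  shows "min (B\<^sup>2 / (2 * T)) T - 1 \<le> real (card S)"
proof -
  \<comment> \<open>For \<open>T - M \<le> x \<le> T\<close>, the bound
    \<open>M \<le> B^2 / (2 * T)\<close> gives \<open>T^2 - x^2 \<le> 2 * T * M \<le> B^2\<close>,
    and \<open>M \<le> T\<close> keeps \<open>x\<close> nonnegative.\<close>
  define M where "M = min (B\<^sup>2 / (2 * T)) T"
  define X where "X = {\<lceil>T - M\<rceil>..\<lfloor>T\<rfloor>}"
  define y where "y x = \<lfloor>sqrt (T\<^sup>2 - (real_of_int x)\<^sup>2)\<rfloor>" for x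
  have M: "M \<le> T" "M * (2 * T) \<le> B\<^sup>2" "M \<ge> 0"
    using T B by (auto simp: M_def min_def field_simps)
  have "(x, y x) \<in> S" if "x \<in> X" for x
  proof (rule S(2))
    have x: "T - M \<le> x" "x \<le> T" using that by (auto simp: X_def le_floor_iff ceiling_le_iff)
    then have "x \<ge> 0" using M(1) by linarith
    define u where "u = T\<^sup>2 - (real_of_int x)\<^sup>2"
    have "(T - M)\<^sup>2 \<le> (real_of_int x)\<^sup>2" using x M(1) by (intro power_mono) auto
    moreover have "(T - M)\<^sup>2 = T\<^sup>2 - M * (2 * T) + M\<^sup>2"
      by (simp add: power2_eq_square algebra_simps)
    ultimately have "u \<le> B\<^sup>2"
      using M(2) zero_le_power2[of M] unfolding u_def by linarith
    then have uB: "sqrt u \<le> B" using B by (intro real_le_lsqrt) auto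
    have u0: "u \<ge> 0"
      using x(2) \<open>x \<ge> 0\<close> by (simp add: u_def power_mono)
    define r where "r = sqrt u"
    have r: "r\<^sup>2 = u" "r \<ge> 0" "r \<le> B" using u0 uB by (auto simp: r_def)
    have yr: "real_of_int (y x) \<le> r" "r < real_of_int (y x) + 1" "y x \<ge> 0"
      using r(2) by (auto simp: y_def r_def u_def)
    have n: "real_of_int (normsq (x, y x)) = (real_of_int x)\<^sup>2 + (real_of_int (y x))\<^sup>2"
      by (simp add: normsq_def)
    have "(real_of_int (y x))\<^sup>2 \<le> r\<^sup>2"
      using yr by (intro power_mono) auto
    then show "real_of_int (normsq (x, y x)) \<le> T\<^sup>2"
      unfolding n using r(1) by (simp add: u_def)
    \<comment> \<open>Rounding \<open>r\<close> down to \<open>y x\<close> lowers its square by at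
      most \<open>2 * r \<le> 2 * B\<close>, the width of the window.\<close>
    have "r\<^sup>2 - 2 * r \<le> (real_of_int (y x))\<^sup>2"
    proof (cases "r \<ge> 1")
      case True
      then have "(r - 1)\<^sup>2 \<le> (real_of_int (y x))\<^sup>2" using yr by (intro power_mono) auto
      then show ?thesis by (simp add: power2_eq_square algebra_simps)
    next
      case False
      then have "r * r \<le> r * 2" using r(2) by (intro mult_left_mono) auto
      then show ?thesis
        using zero_le_power2[of "real_of_int (y x)"] unfolding power2_eq_square by linarith
    qed
    then show "T\<^sup>2 - 2 * B \<le> real_of_int (normsq (x, y x))"
      unfolding n using r by (simp add: u_def)
  qed
  then have "(\<lambda>x. (x, y x)) ` X \<subseteq> S" by auto
  then have "card ((\<lambda>x. (x, y x)) ` X) \<le> card S"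
    by (rule card_mono[OF S(1)])
  moreover have "card ((\<lambda>x. (x, y x)) ` X) = card X"
    by (intro card_image inj_onI) auto
  moreover have "M - 1 \<le> real (card X)"
    unfolding X_def by simp linarith
  ultimately show ?thesis by (simp add: M_def)
qed

subsection \<open>Equidistribution\<close>

definition annulus :: "real \<Rightarrow> real \<Rightarrow> (int \<times> int) set" where
  "annulus \<alpha> h = {k. 4 * pi\<^sup>2 * h\<^sup>2 * of_int (normsq k) \<in> window \<alpha> h}"

lemma annulus_iff:
  assumes "h > 0"
  shows "k \<in> annulus \<alpha> h \<longleftrightarrow> (1 - \<alpha> * h) / (4 * pi\<^sup>2 * h\<^sup>2) \<le> normsq k \<and>
    normsq k \<le> (1 + \<alpha> * h) / (4 * pi\<^sup>2 * h\<^sup>2)"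
  using assms by (simp add: annulus_def window_def field_simps)

lemma finite_annulus:
  assumes "h > 0"
  shows "finite (annulus \<alpha> h)"
proof -
  define n where "n = \<lfloor>(1 + \<alpha> * h) / (4 * pi\<^sup>2 * h\<^sup>2)\<rfloor>"
  have abs_le: "\<bar>x\<bar> \<le> x\<^sup>2" for x :: int
    using mult_left_mono[of 1 "\<bar>x\<bar>" "\<bar>x\<bar>"] by (cases "x = 0") (auto simp: power2_eq_square)
  have "annulus \<alpha> h \<subseteq> {-n..n} \<times> {-n..n}"
  proof
    fix k assume "k \<in> annulus \<alpha> h"
    then have "normsq k \<le> n"
      using assms by (simp add: annulus_iff n_def le_floor_iff)
    then have "\<bar>fst k\<bar> \<le> n" "\<bar>snd k\<bar> \<le> n"
      using abs_le[of "fst k"] abs_le[of "snd k"] zero_le_power2[of "fst k"] zero_le_power2[of "snd k"]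
      unfolding normsq_def by linarith+
    then show "k \<in> {-n..n} \<times> {-n..n}" by (auto simp: mem_Times_iff)
  qed
  then show ?thesis by (rule finite_subset) auto
qed

text \<open>\<open>normsq\<close> ranges over a window of length
  \<open>\<alpha> / (2 * pi^2 * h)\<close>, equality of the norms is the equation of a line, and
  \<open>normsq l \<le> 2 * r^2\<close>.\<close>

lemma card_annulus_line_le:
  assumes "\<alpha> > 0" "h > 0" "l \<noteq> 0" and l: "\<bar>real_of_int (fst l)\<bar> \<le> r" "\<bar>real_of_int (snd l)\<bar> \<le> r"
  shows "real (card {k \<in> annulus \<alpha> h. k + l \<in> annulus \<alpha> h \<and> normsq (k + l) = normsq k})
    \<le> 2 * (1 + r * sqrt (\<alpha> / (pi\<^sup>2 * h)))"
proof -
  have r: "r \<ge> 0" using l(1) by linarith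
  define P where "P = (1 - \<alpha> * h) / (4 * pi\<^sup>2 * h\<^sup>2)"
  define Q where "Q = (1 + \<alpha> * h) / (4 * pi\<^sup>2 * h\<^sup>2)"
  have QP: "Q - P = \<alpha> / (2 * pi\<^sup>2 * h)"
    using assms by (simp add: Q_def P_def field_simps power2_eq_square)
  have "real (card {k \<in> annulus \<alpha> h. k + l \<in> annulus \<alpha> h \<and> normsq (k + l) = normsq k})
      \<le> 2 * (1 + sqrt ((Q - P) * normsq l))"
  proof (rule card_lattice_line[where t = "- normsq l"])
    have "Q - P \<ge> 0" unfolding QP using assms by simp
    then show "P \<le> Q" by simp
    show "finite {k \<in> annulus \<alpha> h. k + l \<in> annulus \<alpha> h \<and> normsq (k + l) = normsq k}"
      using finite_annulus[OF \<open>h > 0\<close>] by simp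
  qed (use assms in \<open>auto simp: normsq_add annulus_iff P_def Q_def\<close>)
  also have "(Q - P) * normsq l \<le> (Q - P) * (2 * r\<^sup>2)"
  proof (rule mult_left_mono)
    have "(real_of_int (fst l))\<^sup>2 \<le> r\<^sup>2" "(real_of_int (snd l))\<^sup>2 \<le> r\<^sup>2"
      using l by (auto simp: abs_le_square_iff [symmetric])
    then show "real_of_int (normsq l) \<le> 2 * r\<^sup>2" by (simp add: normsq_def)
    show "0 \<le> Q - P" unfolding QP using assms by simp
  qed
  also have "(Q - P) * (2 * r\<^sup>2) = r\<^sup>2 * (\<alpha> / (pi\<^sup>2 * h))"
    using assms by (simp add: QP)
  also have "sqrt (r\<^sup>2 * (\<alpha> / (pi\<^sup>2 * h))) = r * sqrt (\<alpha> / (pi\<^sup>2 * h))"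
    using r by (simp only: real_sqrt_mult real_sqrt_abs abs_of_nonneg)
  finally show ?thesis by simp
qed

lemma card_annulus_lower_bound:
  assumes "\<alpha> > 0"
  obtains c where "c > 0" "\<And>h. 0 < h \<Longrightarrow> h \<le> 1 \<Longrightarrow> c / h - 1 \<le> real (card (annulus \<alpha> h))"
proof
  \<comment> \<open>\<open>T\<close> is the outer radius and \<open>2 * B\<close> the length of the
    window of \<open>normsq\<close>. Then \<open>T = q / (2 * pi * h)\<close> and
    \<open>B^2 / (2 * T) = \<alpha>^2 / (16 * pi^3 * q * h)\<close>; the two terms use
    \<open>1 \<le> q\<close> and \<open>q \<le> sqrt (1 + \<alpha>)\<close>.\<close>
  define c where "c = min (\<alpha>\<^sup>2 / (16 * pi ^ 3 * sqrt (1 + \<alpha>))) (1 / (2 * pi))"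
  show "c > 0" using assms by (auto simp: c_def)
  fix h :: real assume h: "0 < h" "h \<le> 1"
  define q where "q = sqrt (1 + \<alpha> * h)"
  define T where "T = q / (2 * pi * h)"
  define B where "B = \<alpha> / (4 * pi\<^sup>2 * h)"
  have "1 + \<alpha> * h > 0" using assms h by (simp add: add_pos_pos)
  then have q: "q > 0" "q\<^sup>2 = 1 + \<alpha> * h" by (auto simp: q_def)
  have "q \<ge> 1" using assms h by (simp add: q_def)
  have "q \<le> sqrt (1 + \<alpha>)" using assms h by (simp add: q_def mult_left_le)
  have T: "T > 0" using q h by (simp add: T_def)
  have B: "B > 0" using assms h by (simp add: B_def)
  have T2: "T\<^sup>2 = (1 + \<alpha> * h) / (4 * pi\<^sup>2 * h\<^sup>2)"
    by (simp add: T_def power_divide q power_mult_distrib)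
  have TB: "T\<^sup>2 - 2 * B = (1 - \<alpha> * h) / (4 * pi\<^sup>2 * h\<^sup>2)"
    unfolding T2 B_def using h by (simp add: field_simps power2_eq_square)
  have "min (B\<^sup>2 / (2 * T)) T - 1 \<le> real (card (annulus \<alpha> h))"
    using h T B by (intro card_annulus_ge finite_annulus) (auto simp: annulus_iff T2[symmetric] TB[symmetric])
  moreover have "c / h \<le> T"
  proof -
    have "c / h \<le> 1 / (2 * pi) / h"
      using h by (intro divide_right_mono) (auto simp: c_def)
    also have "\<dots> \<le> T"
      using h \<open>q \<ge> 1\<close> by (simp add: T_def field_simps)
    finally show ?thesis .
  qed
  moreover have "c / h \<le> B\<^sup>2 / (2 * T)"
  proof -
    have "c / h \<le> \<alpha>\<^sup>2 / (16 * pi ^ 3 * sqrt (1 + \<alpha>)) / h"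
      using h by (intro divide_right_mono) (auto simp: c_def)
    also have "\<dots> \<le> \<alpha>\<^sup>2 / (16 * pi ^ 3 * q) / h"
      using h q assms \<open>q \<le> sqrt (1 + \<alpha>)\<close>
      by (intro divide_right_mono divide_left_mono mult_left_mono) auto
    also have "\<dots> = B\<^sup>2 / (2 * T)"
      using h q by (simp add: B_def T_def field_simps power2_eq_square power3_eq_cube)
    finally show ?thesis .
  qed
  ultimately show "c / h - 1 \<le> real (card (annulus \<alpha> h))" by linarith
qed

section \<open>The spectral space as the span of the modes in the annulus\<close>

lemma coef_eq_0_outside_annulus:
  assumes "E \<in> window \<alpha> h" "eigenfunction h E u" "k \<notin> annulus \<alpha> h"
  shows "coef u k = 0"
  using eigenfunction_coef[OF assms(2), of k] assms by (auto simp: annulus_def)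

lemma fourier_eq_sum:
  assumes "finite C"
  shows "fourier C c = (\<Sum>k\<in>C. scale_L2 (c k) (fourier {k} (\<lambda>_. 1)))"
proof (rule coef_eqI)
  fix k
  have "coef (\<Sum>j\<in>C. scale_L2 (c j) (fourier {j} (\<lambda>_. 1))) k = (\<Sum>j\<in>C. if k = j then c j else 0)"
    unfolding coef_sum coef_scale by (intro sum.cong) (auto simp: coef_fourier)
  then show "coef (fourier C c) k = coef (\<Sum>j\<in>C. scale_L2 (c j) (fourier {j} (\<lambda>_. 1))) k"
    using assms by (simp add: coef_fourier)
qed

lemma inj_fourier_mode: "inj_on (\<lambda>k. fourier {k} (\<lambda>_. 1)) S"
proof (rule inj_onI)
  fix j k :: "int \<times> int"
  assume "fourier {j} (\<lambda>_. 1) = fourier {k} (\<lambda>_. 1)"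
  then have "coef (fourier {j} (\<lambda>_. 1)) j = coef (fourier {k} (\<lambda>_. 1)) j" by simp
  then show "j = k" by (simp add: coef_fourier split: if_splits)
qed

lemma spectral_space_eq:
  assumes "h > 0"
  shows "spectral_space \<alpha> h = L2.span ((\<lambda>k. fourier {k} (\<lambda>_. 1)) ` annulus \<alpha> h)"
    (is "_ = L2.span (?M ` ?S)")
proof
  have "u \<in> L2.span (?M ` ?S)" if u: "E \<in> window \<alpha> h" "eigenfunction h E u" for E u
  proof -
    have "u = fourier ?S (coef u)"
      using coef_eq_0_outside_annulus[OF u] by (intro fourier_coef finite_annulus assms) auto
    also have "\<dots> = (\<Sum>k\<in>?S. scale_L2 (coef u k) (?M k))"
      by (intro fourier_eq_sum finite_annulus assms)
    also have "\<dots> \<in> L2.span (?M ` ?S)"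
      by (intro L2.span_sum L2.span_scale L2.span_base) auto
    finally show ?thesis .
  qed
  then show "spectral_space \<alpha> h \<subseteq> L2.span (?M ` ?S)"
    unfolding spectral_space_def by (intro L2.span_minimal L2.subspace_span) auto
  show "L2.span (?M ` ?S) \<subseteq> spectral_space \<alpha> h"
    unfolding spectral_space_def using eigenfunction_mode
    by (intro L2.span_mono) (auto simp: annulus_def)
qed

lemma spectral_dim_eq_card:
  assumes "h > 0"
  shows "spectral_dim \<alpha> h = card (annulus \<alpha> h)"
proof -
  define M where "M k = fourier {k} (\<lambda>_. 1)" for k
  define S where "S = annulus \<alpha> h"
  have S: "finite S" using finite_annulus[OF assms] by (simp add: S_def)
  have inj: "inj_on M S" unfolding M_def by (rule inj_fourier_mode)
  have "\<not> L2.dependent (M ` S)"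
  proof
    assume "L2.dependent (M ` S)"
    then obtain w v where w: "v \<in> M ` S" "w v \<noteq> 0" "(\<Sum>v\<in>M ` S. scale_L2 (w v) v) = 0"
      using S by (subst (asm) L2.dependent_finite) auto
    then obtain k where k: "k \<in> S" "v = M k" by blast
    have "0 = coef (\<Sum>j\<in>S. scale_L2 (w (M j)) (M j)) k"
      using w(3) by (simp add: sum.reindex[OF inj] coef_zero)
    also have "\<dots> = (\<Sum>j\<in>S. if k = j then w (M j) else 0)"
      unfolding coef_sum coef_scale by (intro sum.cong) (auto simp: M_def coef_fourier)
    also have "\<dots> = w (M k)" using S k by simp
    finally show False using w k by simp
  qed
  then have "L2.dim (L2.span (M ` S)) = card (M ` S)"
    by (simp add: L2.dim_eq_card_independent)
  then show ?thesis
    using spectral_space_eq[OF assms, of \<alpha>] card_image[OF inj]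
    by (simp add: spectral_dim_def M_def S_def)
qed

text \<open>Split \<open>f\<close> into \<open>trig C d\<close> and an error. The error is paired
  with the density (squared norm at most 3) and with the constant 1, which with the same
  \<open>s\<close> gives the terms \<open>3 / (2 * s)\<close> and \<open>1 / (2 * s)\<close>. In the
  polynomial part the frequency 0 cancels by normalization, and the others are bounded by
  \<open>\<delta>\<close>.\<close>

lemma density_integral_diff_le:
  assumes f: "square_integrable f" and S: "finite S" and C: "finite C"
    and circle: "\<And>k. k \<in> S \<Longrightarrow> c k \<noteq> 0 \<Longrightarrow> normsq k = m"
    and norm: "(\<Sum>k\<in>S. (cmod (c k))\<^sup>2) = 1"
    and D: "integrable dx (\<lambda>x. (cmod (f x - trig C d x))\<^sup>2)"
    and corr: "\<And>l. l \<in> C \<Longrightarrow> l \<noteq> 0 \<Longrightarrow> cmod (corr S c l) \<le> \<delta>"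
    and "\<delta> \<ge> 0" "s > 0"
  shows "cmod (density_integral (abs_L2_torus f) (fourier S c) - integral_L2 (abs_L2_torus f)) \<le>
    s * (LINT x|dx. (cmod (f x - trig C d x))\<^sup>2) + 2 / s + \<delta> * (\<Sum>l\<in>C. cmod (d l))"
proof -
  define p where "p = trig C d"
  define w where "w x = complex_of_real ((cmod (trig S c x))\<^sup>2)" for x
  define e where "e x = f x - p x" for x
  define I where "I = (LINT x|dx. (cmod (e x))\<^sup>2)"
  have fm: "f \<in> borel_measurable dx" using f by (simp add: square_integrable_def)
  have contw: "continuous_on square w" unfolding w_def by (intro continuous_intros)
  have contp: "continuous_on square p" unfolding p_def by (intro continuous_intros)
  have em: "e \<in> borel_measurable dx"
    unfolding e_def by (intro borel_measurable_diff fm continuous_on_imp_borel_measurable_dx contp)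
  have ei: "integrable dx (\<lambda>x. (cmod (e x))\<^sup>2)" using D by (simp add: e_def p_def)
  have wm: "w \<in> borel_measurable dx" by (intro continuous_on_imp_borel_measurable_dx contw)
  have "integrable dx (\<lambda>x. Re (w x * w x))"
    by (intro integrable_Re integrable_dx_continuous continuous_intros contw)
  then have wi: "integrable dx (\<lambda>x. (cmod (w x))\<^sup>2)"
    by (simp add: w_def power2_eq_square norm_mult)
  have w3: "(LINT x|dx. (cmod (w x))\<^sup>2) \<le> 3"
    using LINT_trig_fourth_power_le[OF S circle norm] by (simp add: w_def norm_power)
  have one: "(\<lambda>x. 1 :: complex) \<in> borel_measurable dx" "integrable dx (\<lambda>x. (cmod 1)\<^sup>2)" by auto
  have ew: "cmod (LINT x|dx. e x * w x) \<le> (s * I + 3 / s) / 2"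
    using cmod_LINT_product_le[OF em ei wm wi \<open>s > 0\<close>] w3 \<open>s > 0\<close>
    by (simp add: I_def) (smt (verit) divide_right_mono)
  have e1: "cmod (LINT x|dx. e x) \<le> (s * I + 1 / s) / 2"
    using cmod_LINT_product_le[OF em ei one \<open>s > 0\<close>] by (simp add: I_def measure_space_dx)
  have "density_integral (abs_L2_torus f) (fourier S c) = (LINT x|dx. f x * w x)"
    unfolding fourier.abs_eq w_def using f square_integrable_trig
    by (subst density_integral.abs_eq) (auto simp: ae_equal_def)
  also have "\<dots> = (LINT x|dx. e x * w x + p x * w x)"
    by (simp add: e_def left_diff_distrib)
  also have "\<dots> = (LINT x|dx. e x * w x) + (LINT x|dx. p x * w x)"
    by (intro Bochner_Integration.integral_add integrable_dx_product em ei wm wi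
        integrable_dx_continuous continuous_intros contw contp)
  also have "(LINT x|dx. p x * w x) = (\<Sum>l\<in>C. d l * corr S c l)"
  proof -
    have "(LINT x|dx. p x * w x) = (LINT x|dx. (\<Sum>l\<in>C. d l * (mode l x * w x)))"
      by (simp add: p_def trig_def sum_distrib_right mult.assoc)
    also have "\<dots> = (\<Sum>l\<in>C. LINT x|dx. d l * (mode l x * w x))"
      by (intro Bochner_Integration.integral_sum integrable_dx_continuous continuous_intros contw)
    also have "\<dots> = (\<Sum>l\<in>C. d l * corr S c l)"
      by (simp only: integral_mult_right_zero w_def LINT_mode_trig_square[OF S])
    finally show ?thesis .
  qed
  finally have dens: "density_integral (abs_L2_torus f) (fourier S c) =
      (LINT x|dx. e x * w x) + (\<Sum>l\<in>C. d l * corr S c l)" .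
  have e_int: "integrable dx e"
    using integrable_dx_product[OF em ei one] by simp
  have "integral_L2 (abs_L2_torus f) = (LINT x|dx. f x)"
    using f by (subst integral_L2.abs_eq) (auto simp: ae_equal_def)
  also have "\<dots> = (LINT x|dx. e x + p x)"
    by (simp add: e_def)
  also have "\<dots> = (LINT x|dx. e x) + (LINT x|dx. p x)"
    by (intro Bochner_Integration.integral_add e_int integrable_dx_continuous contp)
  also have "(LINT x|dx. p x) = (\<Sum>l\<in>C. LINT x|dx. d l * mode l x)"
    unfolding p_def trig_def
    by (intro Bochner_Integration.integral_sum integrable_dx_continuous continuous_intros)
  also have "\<dots> = (\<Sum>l\<in>C. d l * (if l = 0 then 1 else 0))"
    by (simp only: integral_mult_right_zero LINT_mode)
  finally have diff: "density_integral (abs_L2_torus f) (fourier S c) - integral_L2 (abs_L2_torus f) =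
      (LINT x|dx. e x * w x) - (LINT x|dx. e x) + (\<Sum>l\<in>C. d l * (corr S c l - (if l = 0 then 1 else 0)))"
    unfolding dens by (simp only: right_diff_distrib sum_subtractf) simp
  have main: "cmod (\<Sum>l\<in>C. d l * (corr S c l - (if l = 0 then 1 else 0))) \<le> \<delta> * (\<Sum>l\<in>C. cmod (d l))"
    unfolding sum_distrib_left
  proof (rule sum_norm_le)
    fix l assume "l \<in> C"
    then have "cmod (corr S c l - (if l = 0 then 1 else 0)) \<le> \<delta>"
      using corr corr_zero[OF S, of c] norm \<open>\<delta> \<ge> 0\<close> by auto
    then show "cmod (d l * (corr S c l - (if l = 0 then 1 else 0))) \<le> \<delta> * cmod (d l)"
      using mult_right_mono[OF _ norm_ge_zero[of "d l"]] by (metis norm_mult mult.commute)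
  qed
  have triangle: "cmod (x - y + z) \<le> A + A' + A''"
    if "cmod x \<le> A" "cmod y \<le> A'" "cmod z \<le> A''" for x y z :: complex and A A' A''
    using that norm_triangle_ineq[of "x - y" z] norm_triangle_ineq4[of x y] by linarith
  have "cmod (density_integral (abs_L2_torus f) (fourier S c) - integral_L2 (abs_L2_torus f)) \<le>
      (s * I + 3 / s) / 2 + (s * I + 1 / s) / 2 + \<delta> * (\<Sum>l\<in>C. cmod (d l))"
    unfolding diff by (intro triangle ew e1 main)
  also have "\<dots> = s * I + 2 / s + \<delta> * (\<Sum>l\<in>C. cmod (d l))"
    by (simp add: add_divide_distrib)
  finally show ?thesis by (simp add: I_def e_def p_def)
qed

text \<open>Markov's inequality for the sum over all of \<open>L\<close>: each exceptional
  \<open>j\<close> contributes more than \<open>\<delta>\<close> to the double sum, which is at most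
  \<open>card L * K\<close>.\<close>

lemma card_exceptional_le:
  fixes v :: "'j \<Rightarrow> 'l \<Rightarrow> real" and K :: real
  assumes "finite J" "finite L" "\<delta> > 0" and nonneg: "\<And>j l. v j l \<ge> 0"
    and le: "\<And>l. l \<in> L \<Longrightarrow> (\<Sum>j\<in>J. v j l) \<le> K"
  shows "real (card {j \<in> J. \<exists>l\<in>L. v j l > \<delta>}) \<le> card L * K / \<delta>"
proof -
  define X where "X = {j \<in> J. \<exists>l\<in>L. v j l > \<delta>}"
  have "\<delta> * card X = (\<Sum>j\<in>X. \<delta>)" by simp
  also have "\<dots> \<le> (\<Sum>j\<in>X. \<Sum>l\<in>L. v j l)"
  proof (rule sum_mono)
    fix j assume "j \<in> X"
    then obtain l where l: "l \<in> L" "v j l > \<delta>" by (auto simp: X_def)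
    have "v j l \<le> (\<Sum>l\<in>L. v j l)"
      using assms(2) l nonneg by (intro member_le_sum) auto
    with l show "\<delta> \<le> (\<Sum>l\<in>L. v j l)" by simp
  qed
  also have "\<dots> \<le> (\<Sum>j\<in>J. \<Sum>l\<in>L. v j l)"
    using assms(1) nonneg by (intro sum_mono2 sum_nonneg) (auto simp: X_def)
  also have "\<dots> = (\<Sum>l\<in>L. \<Sum>j\<in>J. v j l)" by (rule sum.swap)
  also have "\<dots> \<le> (\<Sum>l\<in>L. K)" by (intro sum_mono le)
  also have "\<dots> = card L * K" by simp
  finally show ?thesis
    using \<open>\<delta> > 0\<close> by (simp add: X_def pos_le_divide_eq mult.commute)
qed

theorem corollary1p7:
  fixes \<alpha> :: real and \<psi> :: "real \<Rightarrow> nat \<Rightarrow> L2_torus"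
  assumes "\<alpha> > 0"
    and "\<And>h. 0 < h \<Longrightarrow> h \<le> 1 \<Longrightarrow> orthonormal_eigenbasis \<alpha> h (\<psi> h)"
  shows "\<exists>\<Lambda> :: real \<Rightarrow> nat set.
           (\<forall>h. 0 < h \<and> h \<le> 1 \<longrightarrow> \<Lambda> h \<subseteq> {1..spectral_dim \<alpha> h}) \<and>
           ((\<lambda>h. real (card (\<Lambda> h)) / real (spectral_dim \<alpha> h)) \<longlongrightarrow> 1) (at_right 0) \<and>
           (\<forall>a :: L2_torus. \<forall>\<epsilon>>0. \<exists>h0. 0 < h0 \<and> h0 \<le> 1 \<and>
              (\<forall>h. 0 < h \<and> h < h0 \<longrightarrow>
                (\<forall>j\<in>\<Lambda> h. cmod (density_integral a (\<psi> h j) - integral_L2 a) < \<epsilon>)))"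
proof -
  define S where "S h = annulus \<alpha> h" for h
  define J where "J h = {1..spectral_dim \<alpha> h}" for h
  define c where "c h j = coef (\<psi> h j)" for h j
  define r where "r h = h powr (- 1 / 16)" for h :: real
  define L where "L h = {l. l \<noteq> 0 \<and> \<bar>real_of_int (fst l)\<bar> \<le> r h \<and> \<bar>real_of_int (snd l)\<bar> \<le> r h}" for h
  define v where "v h j l = cmod (corr (S h) (c h j) l)" for h j l
  \<comment> \<open>No \<open>a\<close> is involved: the frequency box exhausts the lattice and the
    threshold \<open>1 / r h\<close> tends to 0, so every fixed trigonometric polynomial is
    eventually covered.\<close>
  define \<Lambda> where "\<Lambda> h = {j \<in> J h. \<forall>l\<in>L h. v h j l \<le> 1 / r h}" for h
  have S: "finite (S h)" if "h > 0" for h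
    using finite_annulus[OF that] by (simp add: S_def)
  have psi: "\<psi> h j = fourier (S h) (c h j)" and circle: "\<exists>m. \<forall>k\<in>S h. c h j k \<noteq> 0 \<longrightarrow> normsq k = m"
    if h: "0 < h" "h \<le> 1" and j: "j \<in> J h" for h j
  proof -
    obtain E where E: "E \<in> window \<alpha> h" "eigenfunction h E (\<psi> h j)"
      using assms(2)[OF h] j unfolding orthonormal_eigenbasis_def J_def by blast
    show "\<psi> h j = fourier (S h) (c h j)"
      unfolding c_def using coef_eq_0_outside_annulus[OF E]
      by (intro fourier_coef S h) (auto simp: S_def)
    \<comment> \<open>The quotient is an integer as soon as some coefficient is nonzero; the floor
      makes it an \<open>int\<close> that does not mention \<open>k\<close>.\<close>
    have "normsq k = \<lfloor>E / (4 * pi\<^sup>2 * h\<^sup>2)\<rfloor>" if "c h j k \<noteq> 0" for k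
      using eigenfunction_coef[OF E(2), of k] that h by (simp add: c_def)
    then show "\<exists>m. \<forall>k\<in>S h. c h j k \<noteq> 0 \<longrightarrow> normsq k = m" by blast
  qed
  have orth: "(\<Sum>k\<in>S h. c h i k * cnj (c h j k)) = (if i = j then 1 else 0)"
    if h: "0 < h" "h \<le> 1" and ij: "i \<in> J h" "j \<in> J h" for h i j
  proof -
    have "inner_L2 (\<psi> h i) (\<psi> h j) = (if i = j then 1 else 0)"
      using assms(2)[OF h] ij by (auto simp: orthonormal_eigenbasis_def J_def)
    then show ?thesis
      using S[OF h(1)] by (simp add: psi[OF h ij(1)] psi[OF h ij(2)] inner_fourier)
  qed
  have norm: "(\<Sum>k\<in>S h. (cmod (c h j k))\<^sup>2) = 1" if "0 < h" "h \<le> 1" "j \<in> J h" for h j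
  proof -
    have "complex_of_real (\<Sum>k\<in>S h. (cmod (c h j k))\<^sup>2) = of_real 1"
      using orth[OF that that(3)] by (simp add: of_real_cmod_square del: of_real_power)
    then show ?thesis by (simp only: of_real_eq_iff)
  qed
  have sum_v: "(\<Sum>j\<in>J h. v h j l) \<le> 2 * (1 + r h * sqrt (\<alpha> / (pi\<^sup>2 * h)))"
    if h: "0 < h" "h \<le> 1" and l: "l \<in> L h" for h l
  proof -
    obtain m where m: "\<And>j k. j \<in> J h \<Longrightarrow> k \<in> S h \<Longrightarrow> c h j k \<noteq> 0 \<Longrightarrow> normsq k = m j"
      using circle[OF h] by metis
    have "(\<Sum>j\<in>J h. v h j l) \<le> card {k \<in> S h. k + l \<in> S h \<and> normsq (k + l) = normsq k}"
      unfolding v_def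
    proof (rule sum_corr_le)
      show "(\<Sum>j\<in>J h. (cmod (c h j k))\<^sup>2) \<le> 1" if "k \<in> S h" for k
        by (rule orthonormal_rows_imp_column_le[OF _ S[OF h(1)] that orth[OF h]]) (auto simp: J_def)
    qed (use m S[OF h(1)] in \<open>auto simp: J_def\<close>)
    also have "\<dots> \<le> 2 * (1 + r h * sqrt (\<alpha> / (pi\<^sup>2 * h)))"
      unfolding S_def using l h assms(1) by (intro card_annulus_line_le) (auto simp: L_def)
    finally show ?thesis .
  qed
  have L: "finite (L h)" "real (card (L h)) \<le> (2 * r h + 1)\<^sup>2" for h
  proof -
    define n where "n = \<lfloor>r h\<rfloor>"
    have n: "n \<ge> 0" "real_of_int n \<le> r h" by (auto simp: n_def r_def)
    have sub: "L h \<subseteq> {-n..n} \<times> {-n..n}"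
      by (auto simp: L_def n_def le_floor_iff abs_le_iff minus_le_iff)
    show "finite (L h)"
      by (rule finite_subset[OF sub]) simp
    have "real (card (L h)) \<le> real (card ({-n..n} \<times> {-n..n}))"
      unfolding of_nat_le_iff by (rule card_mono[OF _ sub]) simp
    also have "\<dots> = (2 * real_of_int n + 1)\<^sup>2"
      using n(1) by (simp add: card_cartesian_product power2_eq_square)
    also have "\<dots> \<le> (2 * r h + 1)\<^sup>2"
      using n by (intro power_mono) auto
    finally show "real (card (L h)) \<le> (2 * r h + 1)\<^sup>2" .
  qed
  obtain b where b: "b > 0" "\<And>h. 0 < h \<Longrightarrow> h \<le> 1 \<Longrightarrow> b / h - 1 \<le> real (card (annulus \<alpha> h))"
    using card_annulus_lower_bound[OF assms(1)] by blast
  define N where "N h = real (spectral_dim \<alpha> h)" for h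
  \<comment> \<open>The factors bound the number of frequencies and the sum over the basis for one
    frequency; the last is the inverse of the threshold.\<close>
  define bad where "bad h = (2 * r h + 1)\<^sup>2 * (2 * (1 + r h * sqrt (\<alpha> / (pi\<^sup>2 * h)))) * r h" for h
  have r: "r h > 0" if "h > 0" for h using that by (simp add: r_def)
  have N: "b / h - 1 \<le> N h" if "0 < h" "h \<le> 1" for h
    using b(2) spectral_dim_eq_card that by (simp add: N_def)
  have card_ge: "N h - bad h \<le> real (card (\<Lambda> h))" if h: "0 < h" "h \<le> 1" for h
  proof -
    define X where "X = {j \<in> J h. \<exists>l\<in>L h. v h j l > 1 / r h}"
    have "real (card X) \<le> card (L h) * (2 * (1 + r h * sqrt (\<alpha> / (pi\<^sup>2 * h)))) / (1 / r h)"
      unfolding X_def using r[OF h(1)]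
      by (intro card_exceptional_le L sum_v h) (auto simp: J_def v_def)
    also have "\<dots> \<le> bad h"
      using r[OF h(1)] h assms(1) L(2)[of h] unfolding bad_def
      by (auto intro!: mult_right_mono)
    finally have X: "real (card X) \<le> bad h" .
    have "J h = \<Lambda> h \<union> X" "finite (J h)"
      by (auto simp: \<Lambda>_def X_def J_def not_less)
    then have "card (J h) \<le> card (\<Lambda> h) + card X"
      by (simp add: card_Un_le)
    with X show ?thesis by (simp add: N_def J_def)
  qed
  have card_le: "real (card (\<Lambda> h)) \<le> N h" for h
  proof -
    have "card (\<Lambda> h) \<le> card (J h)"
      by (intro card_mono) (auto simp: J_def \<Lambda>_def)
    then show ?thesis by (simp add: N_def J_def)
  qed
  \<comment> \<open>Positivity of \<open>b / h - 1\<close> makes the dimension positive, so that the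
    quotients below are genuine rather than divisions by 0.\<close>
  have small: "eventually (\<lambda>h. 0 < h \<and> h \<le> 1 \<and> b / h - 1 > 0) (at_right (0::real))"
    using b(1) by (intro eventually_conj) real_asymp+
  have density: "((\<lambda>h. real (card (\<Lambda> h)) / real (spectral_dim \<alpha> h)) \<longlongrightarrow> 1) (at_right 0)"
  proof (rule tendsto_sandwich)
    have "((\<lambda>h. 1 - ((2 * h powr (- 1 / 16) + 1)\<^sup>2 * (2 * (1 + h powr (- 1 / 16) * sqrt (\<alpha> / (pi\<^sup>2 * h)))) *
        h powr (- 1 / 16)) / (b / h - 1)) \<longlongrightarrow> 1) (at_right 0)"
      using b(1) assms(1) by real_asymp
    then show "((\<lambda>h. 1 - bad h / (b / h - 1)) \<longlongrightarrow> 1) (at_right 0)"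
      by (simp add: bad_def r_def)
    show "eventually (\<lambda>h. 1 - bad h / (b / h - 1) \<le> real (card (\<Lambda> h)) / real (spectral_dim \<alpha> h)) (at_right 0)"
      using small
    proof eventually_elim
      case (elim h)
      have "bad h \<ge> 0" using r[of h] elim assms(1) by (simp add: bad_def)
      then have "bad h / N h \<le> bad h / (b / h - 1)"
        using N[of h] elim by (intro divide_left_mono) auto
      moreover have "(N h - bad h) / N h \<le> card (\<Lambda> h) / N h"
        using card_ge[of h] elim by (intro divide_right_mono) (auto simp: N_def)
      moreover have "N h > 0" using N[of h] elim by linarith
      ultimately show ?case by (simp add: diff_divide_distrib N_def)
    qed
    show "eventually (\<lambda>h. real (card (\<Lambda> h)) / real (spectral_dim \<alpha> h) \<le> 1) (at_right 0)"
      using card_le by (intro always_eventually) (auto simp: N_def divide_le_eq_1)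
  qed auto
  have equidist: "\<exists>h0. 0 < h0 \<and> h0 \<le> 1 \<and> (\<forall>h. 0 < h \<and> h < h0 \<longrightarrow>
      (\<forall>j\<in>\<Lambda> h. cmod (density_integral a (\<psi> h j) - integral_L2 a) < \<epsilon>))" if eps: "\<epsilon> > 0" for a \<epsilon>
  proof -
    obtain f where f: "a = abs_L2_torus f" "square_integrable f"
      by (rule L2_torus_cases)
    \<comment> \<open>Taken with \<open>s = 8 / \<epsilon>\<close> below: the approximation costs
      less than \<open>\<epsilon> / 4\<close>, the term \<open>2 / s\<close> is
      \<open>\<epsilon> / 4\<close>, and \<open>\<epsilon> / 2\<close> is left for the
      correlations.\<close>
    obtain C d where C: "finite C" "integrable dx (\<lambda>x. (cmod (f x - trig C d x))\<^sup>2)"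
        "(LINT x|dx. (cmod (f x - trig C d x))\<^sup>2) < \<epsilon>\<^sup>2 / 32"
      using trig_dense[of f "\<epsilon>\<^sup>2 / 32"] f(2) eps by (auto simp: square_integrable_def)
    define D where "D = (\<Sum>l\<in>C. cmod (d l))"
    \<comment> \<open>The finite set \<open>C\<close> depends on \<open>a\<close> and
      \<open>\<epsilon>\<close> but not on \<open>h\<close>, so the growing box eventually contains
      it.\<close>
    have "eventually (\<lambda>h. \<bar>real_of_int (fst l)\<bar> \<le> r h \<and> \<bar>real_of_int (snd l)\<bar> \<le> r h) (at_right 0)" for l
      unfolding r_def by (intro eventually_conj; real_asymp)
    then have "eventually (\<lambda>h. \<forall>l\<in>C. \<bar>real_of_int (fst l)\<bar> \<le> r h \<and> \<bar>real_of_int (snd l)\<bar> \<le> r h) (at_right 0)"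
      using C(1) by (simp add: eventually_ball_finite)
    moreover have "((\<lambda>h. 1 / r h * D) \<longlongrightarrow> 0) (at_right 0)"
      unfolding r_def by real_asymp
    then have "eventually (\<lambda>h. 1 / r h * D < \<epsilon> / 2) (at_right 0)"
      using eps by (intro order_tendstoD) auto
    ultimately have "eventually (\<lambda>h. (\<forall>l\<in>C. \<bar>real_of_int (fst l)\<bar> \<le> r h \<and> \<bar>real_of_int (snd l)\<bar> \<le> r h) \<and>
        1 / r h * D < \<epsilon> / 2) (at_right 0)"
      by (rule eventually_conj)
    then obtain h0 where h0: "h0 > 0" "\<And>h. 0 < h \<Longrightarrow> h < h0 \<Longrightarrow>
        (\<forall>l\<in>C. \<bar>real_of_int (fst l)\<bar> \<le> r h \<and> \<bar>real_of_int (snd l)\<bar> \<le> r h) \<and> 1 / r h * D < \<epsilon> / 2"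
      unfolding eventually_at_right_field by blast
    have "cmod (density_integral a (\<psi> h j) - integral_L2 a) < \<epsilon>"
      if h: "0 < h" "h < min h0 1" and j: "j \<in> \<Lambda> h" for h j
    proof -
      have h1: "h \<le> 1" and jJ: "j \<in> J h" using h j by (auto simp: \<Lambda>_def)
      obtain m where m: "\<And>k. k \<in> S h \<Longrightarrow> c h j k \<noteq> 0 \<Longrightarrow> normsq k = m"
        using circle[OF h(1) h1 jJ] by blast
      have "cmod (corr (S h) (c h j) l) \<le> 1 / r h" if "l \<in> C" "l \<noteq> 0" for l
      proof -
        have "l \<in> L h" using h0(2)[of h] h that by (simp add: L_def)
        then show ?thesis using j by (simp add: \<Lambda>_def v_def)
      qed
      then have "cmod (density_integral a (\<psi> h j) - integral_L2 a) \<le>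
          8 / \<epsilon> * (LINT x|dx. (cmod (f x - trig C d x))\<^sup>2) + 2 / (8 / \<epsilon>) + 1 / r h * D"
        unfolding psi[OF h(1) h1 jJ] f(1) D_def using r[OF h(1)] eps
        by (intro density_integral_diff_le[OF f(2) S[OF h(1)] C(1) m norm[OF h(1) h1 jJ] C(2)]) auto
      also have "\<dots> < 8 / \<epsilon> * (\<epsilon>\<^sup>2 / 32) + 2 / (8 / \<epsilon>) + \<epsilon> / 2"
        using C(3) eps h0(2)[of h] h by (intro add_strict_mono mult_strict_left_mono add_less_le_mono) auto
      also have "\<dots> = \<epsilon>"
        using eps by (simp add: power2_eq_square)
      finally show ?thesis .
    qed
    then show ?thesis
      using h0(1) by (intro exI[of _ "min h0 1"]) auto
  qed
  have "\<Lambda> h \<subseteq> {1..spectral_dim \<alpha> h}" for h by (auto simp: \<Lambda>_def J_def)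
  with density equidist show ?thesis
    by (intro exI[of _ \<Lambda>]) blast
qed

end
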